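(* For any universe $\mathcal{U}$ in the simplicial model of homotopy type theory, sets cover in $\mathcal{U}$; that is, the interpretation in the simplicial model of the statement "for every $X : \mathcal{U}$ there merely exist a $0$-type $S : \mathcal{U}$ and a $(-1)$-connected map $S \to X$" holds (has a global section).
   Context: The metatheory is classical (with the axiom of choice). In the simplicial model (Kapulkin--Lumsdaine), contexts are (Kan) simplicial sets, a type in context $\Gamma$ is a Kan fibration over $\Gamma$, and a term is a section of it. A universe $\mathcal{U}$ in the model is a Kan complex $U_\beta$, for $\beta$ an inaccessible cardinal, which is the base of a univalent Kan fibration classifying the Kan fibrations with $\beta$-small fibres. The statement is, internally, $\prod_{X:\mathcal{U}} \big\| \sum_{S:\mathcal{U}} \mathsf{isSet}(S)\times\sum_{g:S\to X}\mathsf{is}\text{-}(-1)\text{-}\mathsf{connected}(g)\big\|_{-1}$. Here "merely exists" refers to the propositional truncation $\|-\|_{-1}$, and a map is $(-1)$-connected if the propositional truncation of each of its fibres is contractible (equivalently, it is surjective). *)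

theory Defs
  imports Main
begin

unbundle cardinal_syntax

section \<open>Simplicial sets\<close>

text \<open>A monotone map from \<open>[m]\<close> to \<open>[n]\<close> is encoded by the list of its values, so that \<open>hom m n\<close>
  is at the same time the set of \<open>m\<close>-simplices of the standard \<open>n\<close>-simplex, and \<open>m\<close> can be
  recovered from the list.\<close>

definition hom :: "nat \<Rightarrow> nat \<Rightarrow> nat list set" where
  "hom m n = {f. length f = Suc m \<and> sorted f \<and> set f \<subseteq> {..n}}"

definition src :: "nat list \<Rightarrow> nat" where
  "src f = length f - 1"

definition idm :: "nat \<Rightarrow> nat list" where
  "idm n = [0..<Suc n]"

text \<open>\<open>f \<bullet> g\<close> is the composite ``\<open>g\<close> first, then \<open>f\<close>''.\<close>

definition cmp :: "nat list \<Rightarrow> nat list \<Rightarrow> nat list" (infixl \<open>\<bullet>\<close> 75) where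
  "f \<bullet> g = map (\<lambda>i. f ! i) g"

record 'a sset =
  splx :: "nat \<Rightarrow> 'a set"
  restr :: "nat \<Rightarrow> nat list \<Rightarrow> 'a \<Rightarrow> 'a"

definition simplicial_set :: "'a sset \<Rightarrow> bool" where
  "simplicial_set X \<longleftrightarrow>
    (\<forall>m n f. \<forall>x\<in>splx X n. f \<in> hom m n \<longrightarrow> restr X n f x \<in> splx X m) \<and>
    (\<forall>n. \<forall>x\<in>splx X n. restr X n (idm n) x = x) \<and>
    (\<forall>k m n f g. \<forall>x\<in>splx X n. f \<in> hom m n \<longrightarrow> g \<in> hom k m \<longrightarrow>
        restr X m g (restr X n f x) = restr X n (f \<bullet> g) x)"

definition simplicial_map :: "'a sset \<Rightarrow> 'b sset \<Rightarrow> (nat \<Rightarrow> 'a \<Rightarrow> 'b) \<Rightarrow> bool" where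
  "simplicial_map X Y p \<longleftrightarrow>
    (\<forall>n. \<forall>x\<in>splx X n. p n x \<in> splx Y n) \<and>
    (\<forall>m n f. \<forall>x\<in>splx X n. f \<in> hom m n \<longrightarrow> p m (restr X n f x) = restr Y n f (p n x))"

definition Delta :: "nat \<Rightarrow> nat list sset" where
  "Delta n = \<lparr>splx = (\<lambda>m. hom m n), restr = (\<lambda>m f x. x \<bullet> f)\<rparr>"

definition horn :: "nat \<Rightarrow> nat \<Rightarrow> nat list sset" where
  "horn n k = \<lparr>splx = (\<lambda>m. {x \<in> hom m n. \<exists>i\<le>n. i \<noteq> k \<and> i \<notin> set x}), restr = (\<lambda>m f x. x \<bullet> f)\<rparr>"

definition kan_fibration :: "'e sset \<Rightarrow> 'b sset \<Rightarrow> (nat \<Rightarrow> 'e \<Rightarrow> 'b) \<Rightarrow> bool" where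
  "kan_fibration E B p \<longleftrightarrow> simplicial_map E B p \<and>
    (\<forall>n k u v. 1 \<le> n \<longrightarrow> k \<le> n \<longrightarrow>
       simplicial_map (horn n k) E u \<longrightarrow> simplicial_map (Delta n) B v \<longrightarrow>
       (\<forall>m. \<forall>x\<in>splx (horn n k) m. p m (u m x) = v m x) \<longrightarrow>
       (\<exists>w. simplicial_map (Delta n) E w \<and>
            (\<forall>m. \<forall>x\<in>splx (horn n k) m. w m x = u m x) \<and>
            (\<forall>m. \<forall>x\<in>splx (Delta n) m. p m (w m x) = v m x)))"


section \<open>Types and terms in context\<close>

text \<open>A simplicial set over \<open>\<Gamma>\<close> is given by its fibres: \<open>fib A n \<gamma>\<close> is the set of \<open>n\<close>-simplices lying
  over the \<open>n\<close>-simplex \<open>\<gamma>\<close>, and \<open>tr A n \<gamma> f\<close> maps it to the fibre over the restriction of \<open>\<gamma>\<close>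
  along \<open>f\<close>. The corresponding map into \<open>\<Gamma>\<close> is the projection \<open>fst\<close> from \<open>ext \<Gamma> A\<close>; this
  presentation makes substitution strictly functorial.\<close>

record ('g, 'a) fam =
  fib :: "nat \<Rightarrow> 'g \<Rightarrow> 'a set"
  tr :: "nat \<Rightarrow> 'g \<Rightarrow> nat list \<Rightarrow> 'a \<Rightarrow> 'a"

definition family :: "'g sset \<Rightarrow> ('g, 'a) fam \<Rightarrow> bool" where
  "family \<Gamma> A \<longleftrightarrow>
    (\<forall>m n f. \<forall>\<gamma>\<in>splx \<Gamma> n. \<forall>a\<in>fib A n \<gamma>. f \<in> hom m n \<longrightarrow>
        tr A n \<gamma> f a \<in> fib A m (restr \<Gamma> n f \<gamma>)) \<and>
    (\<forall>n. \<forall>\<gamma>\<in>splx \<Gamma> n. \<forall>a\<in>fib A n \<gamma>. tr A n \<gamma> (idm n) a = a) \<and>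
    (\<forall>k m n f g. \<forall>\<gamma>\<in>splx \<Gamma> n. \<forall>a\<in>fib A n \<gamma>. f \<in> hom m n \<longrightarrow> g \<in> hom k m \<longrightarrow>
        tr A m (restr \<Gamma> n f \<gamma>) g (tr A n \<gamma> f a) = tr A n \<gamma> (f \<bullet> g) a)"

definition ext :: "'g sset \<Rightarrow> ('g, 'a) fam \<Rightarrow> ('g \<times> 'a) sset" where
  "ext \<Gamma> A = \<lparr>splx = (\<lambda>n. {(\<gamma>, a). \<gamma> \<in> splx \<Gamma> n \<and> a \<in> fib A n \<gamma>}),
              restr = (\<lambda>n f (\<gamma>, a). (restr \<Gamma> n f \<gamma>, tr A n \<gamma> f a))\<rparr>"

definition is_type :: "'g sset \<Rightarrow> ('g, 'a) fam \<Rightarrow> bool" where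
  "is_type \<Gamma> A \<longleftrightarrow> family \<Gamma> A \<and> kan_fibration (ext \<Gamma> A) \<Gamma> (\<lambda>n. fst)"

definition is_term :: "'g sset \<Rightarrow> ('g, 'a) fam \<Rightarrow> (nat \<Rightarrow> 'g \<Rightarrow> 'a) \<Rightarrow> bool" where
  "is_term \<Gamma> A a \<longleftrightarrow>
    (\<forall>n. \<forall>\<gamma>\<in>splx \<Gamma> n. a n \<gamma> \<in> fib A n \<gamma>) \<and>
    (\<forall>m n f. \<forall>\<gamma>\<in>splx \<Gamma> n. f \<in> hom m n \<longrightarrow> a m (restr \<Gamma> n f \<gamma>) = tr A n \<gamma> f (a n \<gamma>))"

definition subst :: "(nat \<Rightarrow> 'd \<Rightarrow> 'g) \<Rightarrow> ('g, 'a) fam \<Rightarrow> ('d, 'a) fam" where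
  "subst \<sigma> A = \<lparr>fib = (\<lambda>n \<delta>. fib A n (\<sigma> n \<delta>)), tr = (\<lambda>n \<delta>. tr A n (\<sigma> n \<delta>))\<rparr>"

abbreviation wk :: "('g, 'a) fam \<Rightarrow> ('g \<times> 'c, 'a) fam" where
  "wk \<equiv> subst (\<lambda>n. fst)"

definition empty_ctx :: "unit sset" where
  "empty_ctx = \<lparr>splx = (\<lambda>n. {()}), restr = (\<lambda>n f x. x)\<rparr>"

definition const_ty :: "'a sset \<Rightarrow> ('g, 'a) fam" where
  "const_ty X = \<lparr>fib = (\<lambda>n \<gamma>. splx X n), tr = (\<lambda>n \<gamma>. restr X n)\<rparr>"


section \<open>Type formers\<close>

definition sigma_ty :: "('g, 'a) fam \<Rightarrow> ('g \<times> 'a, 'b) fam \<Rightarrow> ('g, 'a \<times> 'b) fam" where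
  "sigma_ty A B = \<lparr>fib = (\<lambda>n \<gamma>. {(a, b). a \<in> fib A n \<gamma> \<and> b \<in> fib B n (\<gamma>, a)}),
                   tr = (\<lambda>n \<gamma> f (a, b). (tr A n \<gamma> f a, tr B n (\<gamma>, a) f b))\<rparr>"

definition prod_ty :: "('g, 'a) fam \<Rightarrow> ('g, 'b) fam \<Rightarrow> ('g, 'a \<times> 'b) fam" where
  "prod_ty A B = sigma_ty A (wk B)"

text \<open>An \<open>n\<close>-simplex of the dependent product over \<open>\<gamma>\<close> is a section of \<open>B\<close> over the pullback of \<open>A\<close>
  along \<open>\<gamma>\<close>, which has as \<open>k\<close>-simplices the pairs of \<open>f \<in> hom k n\<close> and an element of the fibre
  of \<open>A\<close> over the restriction of \<open>\<gamma>\<close> along \<open>f\<close>. Sections are made \<open>undefined\<close> off their domain, so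
  that equality of simplices is equality of functions.\<close>

definition pi_ty :: "'g sset \<Rightarrow> ('g, 'a) fam \<Rightarrow> ('g \<times> 'a, 'b) fam \<Rightarrow> ('g, nat list \<Rightarrow> 'a \<Rightarrow> 'b) fam"
  where
  "pi_ty \<Gamma> A B =
    \<lparr>fib = (\<lambda>n \<gamma>. {\<phi>.
        (\<forall>k. \<forall>f\<in>hom k n. \<forall>a\<in>fib A k (restr \<Gamma> n f \<gamma>). \<phi> f a \<in> fib B k (restr \<Gamma> n f \<gamma>, a)) \<and>
        (\<forall>j k. \<forall>f\<in>hom k n. \<forall>g\<in>hom j k. \<forall>a\<in>fib A k (restr \<Gamma> n f \<gamma>).
            \<phi> (f \<bullet> g) (tr A k (restr \<Gamma> n f \<gamma>) g a) = tr B k (restr \<Gamma> n f \<gamma>, a) g (\<phi> f a)) \<and>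
        (\<forall>f a. \<not> (f \<in> hom (src f) n \<and> a \<in> fib A (src f) (restr \<Gamma> n f \<gamma>)) \<longrightarrow> \<phi> f a = undefined)}),
     tr = (\<lambda>n \<gamma> g \<phi> f a.
        if f \<in> hom (src f) (src g) \<and> a \<in> fib A (src f) (restr \<Gamma> n (g \<bullet> f) \<gamma>)
        then \<phi> (g \<bullet> f) a else undefined)\<rparr>"

definition arrow_ty :: "'g sset \<Rightarrow> ('g, 'a) fam \<Rightarrow> ('g, 'b) fam \<Rightarrow> ('g, nat list \<Rightarrow> 'a \<Rightarrow> 'b) fam" where
  "arrow_ty \<Gamma> A B = pi_ty \<Gamma> A (wk B)"

text \<open>Evaluation of a term of a dependent product at a term of its domain.\<close>

definition app :: "(nat \<Rightarrow> 'g \<Rightarrow> nat list \<Rightarrow> 'a \<Rightarrow> 'b) \<Rightarrow> (nat \<Rightarrow> 'g \<Rightarrow> 'a) \<Rightarrow> nat \<Rightarrow> 'g \<Rightarrow> 'b" where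
  "app g a = (\<lambda>n \<gamma>. g n \<gamma> (idm n) (a n \<gamma>))"

text \<open>Identity types are fibred path objects: an \<open>n\<close>-simplex over \<open>\<gamma>\<close> is a map \<open>\<rho>\<close> over \<open>\<Gamma>\<close> from
  \<open>\<Delta>[n] \<times> \<Delta>[1]\<close>, lying over \<open>\<gamma>\<close> composed with the first projection, to \<open>A\<close>, with restrictions to
  the two ends of \<open>\<Delta>[1]\<close> given by \<open>a\<close> and \<open>b\<close>.\<close>

definition id_ty :: "'g sset \<Rightarrow> ('g, 'a) fam \<Rightarrow> (nat \<Rightarrow> 'g \<Rightarrow> 'a) \<Rightarrow> (nat \<Rightarrow> 'g \<Rightarrow> 'a) \<Rightarrow>
    ('g, nat list \<Rightarrow> nat list \<Rightarrow> 'a) fam" where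
  "id_ty \<Gamma> A a b =
    \<lparr>fib = (\<lambda>n \<gamma>. {\<rho>.
        (\<forall>k. \<forall>f\<in>hom k n. \<forall>h\<in>hom k 1. \<rho> f h \<in> fib A k (restr \<Gamma> n f \<gamma>)) \<and>
        (\<forall>j k. \<forall>f\<in>hom k n. \<forall>h\<in>hom k 1. \<forall>g\<in>hom j k.
            \<rho> (f \<bullet> g) (h \<bullet> g) = tr A k (restr \<Gamma> n f \<gamma>) g (\<rho> f h)) \<and>
        (\<forall>k. \<forall>f\<in>hom k n. \<rho> f (replicate (Suc k) 0) = tr A n \<gamma> f (a n \<gamma>)) \<and>
        (\<forall>k. \<forall>f\<in>hom k n. \<rho> f (replicate (Suc k) 1) = tr A n \<gamma> f (b n \<gamma>)) \<and>
        (\<forall>f h. \<not> (f \<in> hom (src f) n \<and> h \<in> hom (src f) 1) \<longrightarrow> \<rho> f h = undefined)}),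
     tr = (\<lambda>n \<gamma> g \<rho> f h.
        if f \<in> hom (src f) (src g) \<and> h \<in> hom (src f) 1 then \<rho> (g \<bullet> f) h else undefined)\<rparr>"

definition isprop_ty where
  "isprop_ty \<Gamma> A =
    pi_ty \<Gamma> A (pi_ty (ext \<Gamma> A) (wk A)
      (id_ty (ext (ext \<Gamma> A) (wk A)) (wk (wk A)) (\<lambda>n \<gamma>. snd (fst \<gamma>)) (\<lambda>n \<gamma>. snd \<gamma>)))"

definition isset_ty where
  "isset_ty \<Gamma> A =
    pi_ty \<Gamma> A (pi_ty (ext \<Gamma> A) (wk A)
      (isprop_ty (ext (ext \<Gamma> A) (wk A))
        (id_ty (ext (ext \<Gamma> A) (wk A)) (wk (wk A)) (\<lambda>n \<gamma>. snd (fst \<gamma>)) (\<lambda>n \<gamma>. snd \<gamma>))))"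

definition iscontr_ty where
  "iscontr_ty \<Gamma> A =
    sigma_ty A (pi_ty (ext \<Gamma> A) (wk A)
      (id_ty (ext (ext \<Gamma> A) (wk A)) (wk (wk A)) (\<lambda>n \<gamma>. snd (fst \<gamma>)) (\<lambda>n \<gamma>. snd \<gamma>)))"

definition fibre_ty where
  "fibre_ty \<Gamma> A B g y =
    sigma_ty A (id_ty (ext \<Gamma> A) (wk B)
      (app (\<lambda>n \<gamma>. g n (fst \<gamma>)) (\<lambda>n \<gamma>. snd \<gamma>)) (\<lambda>n \<gamma>. y n (fst \<gamma>)))"

text \<open>\<open>T\<close> with constructor \<open>\<eta>\<close> satisfies the rules of the propositional truncation of \<open>A\<close>: it is a
  proposition, and every family of propositions over it that has an element over each \<open>\<eta> a\<close> has a
  section. No computation rule is imposed: it holds up to identity, the motive being a proposition.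
  For a type \<open>A\<close> in context \<open>\<Gamma>\<close> these rules determine \<open>T\<close> up to equivalence over \<open>\<Gamma>\<close>, and hence are
  stable under substitution. HOL forces a choice of one type for the elements of the motive \<open>P\<close>;
  this is no restriction, since every proposition in the model is equivalent to a subobject of its
  context, which can be presented with fibres in any given nonempty type.\<close>

definition prop_trunc :: "'g sset \<Rightarrow> ('g, 'a) fam \<Rightarrow> ('g, 't) fam \<Rightarrow> (nat \<Rightarrow> 'g \<times> 'a \<Rightarrow> 't) \<Rightarrow> bool"
  where
  "prop_trunc \<Gamma> A T \<eta> \<longleftrightarrow>
    is_type \<Gamma> T \<and>
    is_term (ext \<Gamma> A) (wk T) \<eta> \<and>
    (\<exists>h. is_term \<Gamma> (isprop_ty \<Gamma> T) h) \<and>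
    (\<forall>P :: ('g \<times> 't, 't) fam.
       is_type (ext \<Gamma> T) P \<longrightarrow>
       (\<exists>h. is_term (ext \<Gamma> T) (isprop_ty (ext \<Gamma> T) P) h) \<longrightarrow>
       (\<exists>d. is_term (ext \<Gamma> A) (subst (\<lambda>n \<gamma>. (fst \<gamma>, \<eta> n \<gamma>)) P) d) \<longrightarrow>
       (\<exists>e. is_term (ext \<Gamma> T) P e))"


section \<open>Universes\<close>

definition inaccessible :: "'b rel \<Rightarrow> bool" where
  "inaccessible \<beta> \<longleftrightarrow> Card_order \<beta> \<and> natLeq <o \<beta> \<and> regularCard \<beta> \<and>
    (\<forall>A \<subseteq> Field \<beta>. |A| <o \<beta> \<longrightarrow> |Pow A| <o \<beta>)"

definition precomp :: "nat \<Rightarrow> nat list \<Rightarrow> (nat list, 'b) fam \<Rightarrow> (nat list, 'b) fam" where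
  "precomp n f A =
    \<lparr>fib = (\<lambda>k x. if x \<in> hom k (src f) then fib A k (f \<bullet> x) else {}),
     tr = (\<lambda>k x g a. if x \<in> hom k (src f) \<and> g \<in> hom (src g) k \<and> a \<in> fib A k (f \<bullet> x)
                     then tr A k (f \<bullet> x) g a else undefined)\<rparr>"

text \<open>The \<open>n\<close>-simplices of the universe are the isomorphism classes of Kan fibrations over \<open>\<Delta>[n]\<close>
  equipped with well-orderings of their fibres, these having cardinality less than \<open>\<beta>\<close>. Isomorphisms
  preserve the well-orderings. Since \<open>\<beta>\<close> is an initial ordinal, each class contains exactly one
  family all of whose fibres are proper initial segments of \<open>\<beta>\<close>, and this family represents it.
  The condition \<open>precomp n (idm n) A = A\<close> only normalises \<open>A\<close> off its domain.\<close>

definition univ :: "'b rel \<Rightarrow> (nat list, 'b) fam sset" where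
  "univ \<beta> =
    \<lparr>splx = (\<lambda>n. {A. is_type (Delta n) A \<and>
                     (\<forall>k. \<forall>x\<in>hom k n. \<exists>b\<in>Field \<beta>. fib A k x = underS \<beta> b) \<and>
                     precomp n (idm n) A = A}),
     restr = precomp\<rparr>"

text \<open>The type classified by \<open>\<sigma>\<close>: the pullback along \<open>\<sigma>\<close> of the universal fibration, whose fibre
  over a simplex \<open>A\<close> of the universe consists of the elements of \<open>A\<close> over the nondegenerate top
  simplex.\<close>

definition el_ty :: "(nat \<Rightarrow> 'g \<Rightarrow> (nat list, 'b) fam) \<Rightarrow> ('g, 'b) fam" where
  "el_ty \<sigma> = subst \<sigma> \<lparr>fib = (\<lambda>n A. fib A n (idm n)), tr = (\<lambda>n A. tr A n (idm n))\<rparr>"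


section \<open>Sets cover\<close>

text \<open>Contexts \<open>X : U\<close>; then \<open>S : U\<close>; then \<open>g : S \<rightarrow> X\<close>; then \<open>x : X\<close>.\<close>

definition ctx_X where
  "ctx_X \<beta> = ext empty_ctx (const_ty (univ \<beta>))"

definition ctx_XS where
  "ctx_XS \<beta> = ext (ctx_X \<beta>) (const_ty (univ \<beta>))"

definition map_ty where
  "map_ty \<beta> = arrow_ty (ctx_XS \<beta>) (el_ty (\<lambda>n \<gamma>. snd \<gamma>)) (el_ty (\<lambda>n \<gamma>. snd (fst \<gamma>)))"

definition ctx_XSg where
  "ctx_XSg \<beta> = ext (ctx_XS \<beta>) (map_ty \<beta>)"

definition ctx_XSgx where
  "ctx_XSgx \<beta> = ext (ctx_XSg \<beta>) (el_ty (\<lambda>n \<gamma>. snd (fst (fst \<gamma>))))"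

text \<open>The homotopy fibre of \<open>g\<close> over \<open>x\<close>.\<close>

definition fib_g_x where
  "fib_g_x \<beta> =
    fibre_ty (ctx_XSgx \<beta>)
      (el_ty (\<lambda>n \<gamma>. snd (fst (fst \<gamma>))))
      (el_ty (\<lambda>n \<gamma>. snd (fst (fst (fst \<gamma>)))))
      (\<lambda>n \<gamma>. snd (fst \<gamma>))
      (\<lambda>n \<gamma>. snd \<gamma>)"

text \<open>In the following, \<open>T\<close> stands for the propositional truncation of \<open>fib_g_x \<beta>\<close>.\<close>

definition conn_ty where
  "conn_ty \<beta> T =
    pi_ty (ctx_XSg \<beta>) (el_ty (\<lambda>n \<gamma>. snd (fst (fst \<gamma>)))) (iscontr_ty (ctx_XSgx \<beta>) T)"

definition set_cover_ty where
  "set_cover_ty \<beta> T =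
    sigma_ty (const_ty (univ \<beta>))
      (prod_ty (isset_ty (ctx_XS \<beta>) (el_ty (\<lambda>n \<gamma>. snd \<gamma>)))
               (sigma_ty (map_ty \<beta>) (conn_ty \<beta> T)))"

end

theory Submission
  imports Defs
begin

text \<open>A fibration with a homotopy between any two points of a fibre has fillers for boundaries: fill
  a horn, then move the result along the homotopy by extending over a prism. Hence, if moreover the
  fibres over vertices are inhabited, it has a section, built one nondegenerate simplex at a time.
  The propositional truncation \<open>M\<close> is such a fibration over \<open>U\<close> as soon as every vertex \<open>X\<close> of \<open>U\<close>
  is covered by a set, and the discrete set \<open>X\<^sub>0\<close> of vertices of \<open>X\<close> covers it: the
  truncation \<open>T\<close> of the fibres of \<open>X\<^sub>0 \<rightarrow> X\<close> is again a fibration of this kind, since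
  every vertex of \<open>X\<close> is in the image, so it has a section over \<open>X\<close>.\<close>

section \<open>Monotone maps and simplicial sets\<close>

text \<open>The set of vertices is not invariant under equivalence, so the passage from X to X_0
  does not extend along the edges of U, and it yields no section of the untruncated type. Truncation
  confines the problem to vertices: there the witnesses are chosen without any coherence, and Zorn's
  lemma makes the choices in higher dimensions. The same happens inside X: a vertex is its own
  preimage up to a constant path, whereas a nondegenerate simplex of positive dimension need not
  lift to X_0.

  An element of a dependent product over one vertex is still a section over all degeneracies of that
  vertex. Such elements are found as values of terms over the copy of \<Delta>[0] that the vertex
  generates. The type formers use the base context only through \<open>restr\<close>, so the types
  over this subobject are literally those over the whole context, and no comparison along a
  substitution is required.\<close>

lemma hom_iff_nth:
  "x \<in> hom m n \<longleftrightarrow> length x = Suc m \<and> (\<forall>i j. i \<le> j \<longrightarrow> j \<le> m \<longrightarrow> x ! i \<le> x ! j) \<and> (\<forall>i\<le>m. x ! i \<le> n)"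
proof -
  have "set x \<subseteq> {..n} \<longleftrightarrow> (\<forall>i\<le>m. x ! i \<le> n)" if "length x = Suc m"
    using that by (auto simp: subset_iff in_set_conv_nth less_Suc_eq_le)
  then show ?thesis
    by (auto simp: hom_def sorted_iff_nth_mono less_Suc_eq_le)
qed

lemma src_hom: "f \<in> hom m n \<Longrightarrow> src f = m"
  by (simp add: hom_def src_def)

lemma length_hom: "f \<in> hom m n \<Longrightarrow> length f = Suc m"
  by (simp add: hom_def)

lemma nth_hom_le: "f \<in> hom m n \<Longrightarrow> i \<le> m \<Longrightarrow> f ! i \<le> n"
  by (simp add: hom_iff_nth)

lemma src_cmp [simp]: "src (f \<bullet> g) = src g"
  by (simp add: src_def cmp_def)

lemma src_idm [simp]: "src (idm n) = n"
  by (simp add: src_def idm_def)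

lemma cmp_nth: "i < length g \<Longrightarrow> (f \<bullet> g) ! i = f ! (g ! i)"
  by (simp add: cmp_def)

lemma cmp_hom [simp, intro]: "f \<in> hom m n \<Longrightarrow> g \<in> hom k m \<Longrightarrow> f \<bullet> g \<in> hom k n"
  by (auto simp: hom_iff_nth cmp_def)

lemma idm_hom [simp, intro]: "idm n \<in> hom n n"
  by (auto simp: hom_iff_nth idm_def simp del: upt_Suc)

lemma cmp_assoc: "g \<in> hom k m \<Longrightarrow> h \<in> hom j k \<Longrightarrow> (f \<bullet> g) \<bullet> h = f \<bullet> (g \<bullet> h)"
  by (auto simp: cmp_def hom_def less_Suc_eq_le subset_iff)

lemma cmp_idm [simp]: "f \<in> hom m n \<Longrightarrow> f \<bullet> idm m = f"
  using map_nth[of f] by (simp add: cmp_def idm_def hom_def)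

lemma idm_cmp [simp]: "f \<in> hom m n \<Longrightarrow> idm n \<bullet> f = f"
  by (auto simp: cmp_def idm_def hom_def less_Suc_eq_le subset_iff intro!: map_idI simp del: upt_Suc)

lemma replicate_hom: "c \<le> n \<Longrightarrow> replicate (Suc k) c \<in> hom k n"
  by (auto simp: hom_iff_nth less_Suc_eq_le simp del: replicate_Suc)

lemma hom_0_iff: "f \<in> hom m 0 \<longleftrightarrow> f = replicate (Suc m) 0"
  by (auto simp: hom_iff_nth list_eq_iff_nth_eq less_Suc_eq_le simp del: replicate_Suc)

lemma map_hom:
  assumes "x \<in> hom m n" "\<And>i j. i \<le> j \<Longrightarrow> j \<le> n \<Longrightarrow> F i \<le> F j" "\<And>i. i \<le> n \<Longrightarrow> F i \<le> n'"
  shows "map F x \<in> hom m n'"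
  using assms by (auto simp: hom_iff_nth)

text \<open>Turns a function on numbers into a simplicial operator: cofaces and codegeneracies act
  on values by \<open>map\<close>, whereas \<open>restr\<close> and \<open>tr\<close> expect a list,
  and \<open>map F (idm n)\<close> is that list.\<close>

lemma map_idm_cmp: "x \<in> hom m n \<Longrightarrow> map F (idm n) \<bullet> x = map F x"
  by (auto simp: cmp_def idm_def hom_def less_Suc_eq_le subset_iff simp del: upt_Suc)

lemma map_cmp: "x \<in> hom m n \<Longrightarrow> g \<in> hom k m \<Longrightarrow> map F (x \<bullet> g) = map F x \<bullet> g"
  by (auto simp: cmp_def hom_def less_Suc_eq_le subset_iff)

lemma restr_in: "simplicial_set X \<Longrightarrow> x \<in> splx X n \<Longrightarrow> f \<in> hom m n \<Longrightarrow> restr X n f x \<in> splx X m"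
  by (simp add: simplicial_set_def)

lemma restr_idm: "simplicial_set X \<Longrightarrow> x \<in> splx X n \<Longrightarrow> restr X n (idm n) x = x"
  by (simp add: simplicial_set_def)

lemma restr_cmp: "simplicial_set X \<Longrightarrow> x \<in> splx X n \<Longrightarrow> f \<in> hom m n \<Longrightarrow> g \<in> hom k m
   \<Longrightarrow> restr X m g (restr X n f x) = restr X n (f \<bullet> g) x"
  unfolding simplicial_set_def by blast

lemma simplicial_setI:
  assumes "\<And>m n f x. x \<in> splx X n \<Longrightarrow> f \<in> hom m n \<Longrightarrow> restr X n f x \<in> splx X m"
    and "\<And>n x. x \<in> splx X n \<Longrightarrow> restr X n (idm n) x = x"
    and "\<And>k m n f g x. x \<in> splx X n \<Longrightarrow> f \<in> hom m n \<Longrightarrow> g \<in> hom k m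
           \<Longrightarrow> restr X m g (restr X n f x) = restr X n (f \<bullet> g) x"
  shows "simplicial_set X"
  unfolding simplicial_set_def by (intro conjI allI ballI impI; rule assms; assumption)

lemma splx_Delta [simp]: "splx (Delta n) m = hom m n"
  and restr_Delta [simp]: "restr (Delta n) m f x = x \<bullet> f"
  by (simp_all add: Delta_def)

lemma simplicial_set_Delta: "simplicial_set (Delta n)"
  by (rule simplicial_setI) (auto simp: cmp_assoc)

lemma splx_horn: "splx (horn n k) m = {x \<in> hom m n. \<exists>i\<le>n. i \<noteq> k \<and> i \<notin> set x}"
  and restr_horn [simp]: "restr (horn n k) m f x = x \<bullet> f"
  by (simp_all add: horn_def)

lemma set_cmp_subset: "f \<in> hom m n \<Longrightarrow> g \<in> hom k m \<Longrightarrow> set (f \<bullet> g) \<subseteq> set f"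
  by (auto simp: cmp_def hom_def less_Suc_eq_le subset_iff)

text \<open>Throughout, \<open>set f \<noteq> {..n}\<close> expresses that \<open>f\<close> lies in
  the boundary of \<Delta>[n]. Restriction can only shrink the image, so the boundary is a
  simplicial subset.\<close>

lemma set_cmp_proper:
  assumes "f \<in> hom m n" "set f \<noteq> {..n}" "g \<in> hom j m"
  shows "set (f \<bullet> g) \<noteq> {..n}"
  using set_cmp_subset[OF assms(1,3)] assms(1,2) by (auto simp: hom_def)

lemma simplicial_map_in: "simplicial_map X Y p \<Longrightarrow> x \<in> splx X n \<Longrightarrow> p n x \<in> splx Y n"
  by (simp add: simplicial_map_def)

lemma simplicial_map_restr: "simplicial_map X Y p \<Longrightarrow> x \<in> splx X n \<Longrightarrow> f \<in> hom m n
   \<Longrightarrow> p m (restr X n f x) = restr Y n f (p n x)"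
  by (simp add: simplicial_map_def)

lemma simplicial_mapI:
  assumes "\<And>n x. x \<in> splx X n \<Longrightarrow> p n x \<in> splx Y n"
    and "\<And>m n f x. x \<in> splx X n \<Longrightarrow> f \<in> hom m n \<Longrightarrow> p m (restr X n f x) = restr Y n f (p n x)"
  shows "simplicial_map X Y p"
  unfolding simplicial_map_def by (intro conjI allI ballI impI; rule assms; assumption)

lemma simplicial_map_comp:
  assumes "simplicial_map X Y p" "simplicial_map Y Z q"
  shows "simplicial_map X Z (\<lambda>n x. q n (p n x))"
  using assms by (simp add: simplicial_map_def)

section \<open>Families, types and terms\<close>

lemma tr_in: "family \<Gamma> A \<Longrightarrow> \<gamma> \<in> splx \<Gamma> n \<Longrightarrow> a \<in> fib A n \<gamma> \<Longrightarrow> f \<in> hom m n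
   \<Longrightarrow> tr A n \<gamma> f a \<in> fib A m (restr \<Gamma> n f \<gamma>)"
  by (simp add: family_def)

lemma tr_idm: "family \<Gamma> A \<Longrightarrow> \<gamma> \<in> splx \<Gamma> n \<Longrightarrow> a \<in> fib A n \<gamma> \<Longrightarrow> tr A n \<gamma> (idm n) a = a"
  by (simp add: family_def)

lemma tr_cmp: "family \<Gamma> A \<Longrightarrow> \<gamma> \<in> splx \<Gamma> n \<Longrightarrow> a \<in> fib A n \<gamma> \<Longrightarrow> f \<in> hom m n \<Longrightarrow> g \<in> hom k m
   \<Longrightarrow> tr A m (restr \<Gamma> n f \<gamma>) g (tr A n \<gamma> f a) = tr A n \<gamma> (f \<bullet> g) a"
  unfolding family_def by blast

lemma familyI:
  assumes "\<And>m n f \<gamma> a. \<gamma> \<in> splx \<Gamma> n \<Longrightarrow> a \<in> fib A n \<gamma> \<Longrightarrow> f \<in> hom m n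
             \<Longrightarrow> tr A n \<gamma> f a \<in> fib A m (restr \<Gamma> n f \<gamma>)"
    and "\<And>n \<gamma> a. \<gamma> \<in> splx \<Gamma> n \<Longrightarrow> a \<in> fib A n \<gamma> \<Longrightarrow> tr A n \<gamma> (idm n) a = a"
    and "\<And>k m n f g \<gamma> a. \<gamma> \<in> splx \<Gamma> n \<Longrightarrow> a \<in> fib A n \<gamma> \<Longrightarrow> f \<in> hom m n \<Longrightarrow> g \<in> hom k m
           \<Longrightarrow> tr A m (restr \<Gamma> n f \<gamma>) g (tr A n \<gamma> f a) = tr A n \<gamma> (f \<bullet> g) a"
  shows "family \<Gamma> A"
  unfolding family_def by (intro conjI allI ballI impI; rule assms; assumption)

lemma is_term_in: "is_term \<Gamma> A a \<Longrightarrow> \<gamma> \<in> splx \<Gamma> n \<Longrightarrow> a n \<gamma> \<in> fib A n \<gamma>"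
  by (simp add: is_term_def)

lemma is_term_restr: "is_term \<Gamma> A a \<Longrightarrow> \<gamma> \<in> splx \<Gamma> n \<Longrightarrow> f \<in> hom m n
   \<Longrightarrow> a m (restr \<Gamma> n f \<gamma>) = tr A n \<gamma> f (a n \<gamma>)"
  by (simp add: is_term_def)

lemma is_termI:
  assumes "\<And>n \<gamma>. \<gamma> \<in> splx \<Gamma> n \<Longrightarrow> a n \<gamma> \<in> fib A n \<gamma>"
    and "\<And>m n f \<gamma>. \<gamma> \<in> splx \<Gamma> n \<Longrightarrow> f \<in> hom m n \<Longrightarrow> a m (restr \<Gamma> n f \<gamma>) = tr A n \<gamma> f (a n \<gamma>)"
  shows "is_term \<Gamma> A a"
  unfolding is_term_def by (intro conjI allI ballI impI; rule assms; assumption)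

lemma splx_ext [simp]: "(\<gamma>, a) \<in> splx (ext \<Gamma> A) n \<longleftrightarrow> \<gamma> \<in> splx \<Gamma> n \<and> a \<in> fib A n \<gamma>"
  and restr_ext [simp]: "restr (ext \<Gamma> A) n f (\<gamma>, a) = (restr \<Gamma> n f \<gamma>, tr A n \<gamma> f a)"
  by (simp_all add: ext_def)

lemma fib_subst [simp]: "fib (subst \<sigma> A) n \<delta> = fib A n (\<sigma> n \<delta>)"
  and tr_subst [simp]: "tr (subst \<sigma> A) n \<delta> = tr A n (\<sigma> n \<delta>)"
  by (simp_all add: subst_def)

lemma simplicial_set_ext:
  assumes "simplicial_set \<Gamma>" "family \<Gamma> A"
  shows "simplicial_set (ext \<Gamma> A)"
  by (rule simplicial_setI)
    (use assms in \<open>auto simp: restr_in restr_idm restr_cmp tr_in tr_idm tr_cmp\<close>)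

lemma simplicial_map_fst: "simplicial_map (ext \<Gamma> A) \<Gamma> (\<lambda>n. fst)"
  by (rule simplicial_mapI) auto

lemma simplicial_map_snd_const:
  "simplicial_map (ext \<Gamma> (const_ty X)) X (\<lambda>n. snd)"
  by (rule simplicial_mapI) (auto simp: const_ty_def)

lemma family_subst:
  assumes "simplicial_map \<Delta> \<Gamma> \<sigma>" "family \<Gamma> A"
  shows "family \<Delta> (subst \<sigma> A)"
proof (rule familyI)
  fix m n f \<delta> a assume *: "\<delta> \<in> splx \<Delta> n" "a \<in> fib (subst \<sigma> A) n \<delta>" "f \<in> hom m n"
  then show "tr (subst \<sigma> A) n \<delta> f a \<in> fib (subst \<sigma> A) m (restr \<Delta> n f \<delta>)"
    using tr_in[OF assms(2)] simplicial_map_in[OF assms(1)] simplicial_map_restr[OF assms(1)] by simp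
  fix k g assume "g \<in> hom k m"
  with * show "tr (subst \<sigma> A) m (restr \<Delta> n f \<delta>) g (tr (subst \<sigma> A) n \<delta> f a) = tr (subst \<sigma> A) n \<delta> (f \<bullet> g) a"
    using tr_cmp[OF assms(2)] simplicial_map_in[OF assms(1)] simplicial_map_restr[OF assms(1)] by simp
next
  fix n \<delta> a assume "\<delta> \<in> splx \<Delta> n" "a \<in> fib (subst \<sigma> A) n \<delta>"
  then show "tr (subst \<sigma> A) n \<delta> (idm n) a = a"
    using tr_idm[OF assms(2)] simplicial_map_in[OF assms(1)] by simp
qed

lemma family_wk: "family \<Gamma> A \<Longrightarrow> family (ext \<Gamma> C) (wk A)"
  by (rule family_subst[OF simplicial_map_fst])

lemma family_const: "simplicial_set X \<Longrightarrow> family \<Gamma> (const_ty X)"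
  by (rule familyI) (auto simp: const_ty_def restr_in restr_idm restr_cmp)

lemma is_type_family: "is_type \<Gamma> A \<Longrightarrow> family \<Gamma> A"
  by (simp add: is_type_def)

text \<open>A horn in \<open>B\<close> is pushed into \<open>A\<close>, filled there, and the filler
  is pulled back. \<open>B\<close> is compared with \<open>subst \<sigma> A\<close> on the domain
  only, because families such as \<open>precomp n f A\<close> are empty or \<open>undefined\<close>
  elsewhere and so differ from the substituted ones.\<close>

lemma is_type_pullback:
  assumes \<sigma>: "simplicial_map \<Delta> \<Gamma> \<sigma>" and A: "is_type \<Gamma> A"
    and \<Delta>: "simplicial_set \<Delta>"
    and fib: "\<And>n \<delta>. \<delta> \<in> splx \<Delta> n \<Longrightarrow> fib B n \<delta> = fib A n (\<sigma> n \<delta>)"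
    and tr: "\<And>m n \<delta> f a. \<delta> \<in> splx \<Delta> n \<Longrightarrow> f \<in> hom m n \<Longrightarrow> a \<in> fib A n (\<sigma> n \<delta>)
      \<Longrightarrow> tr B n \<delta> f a = tr A n (\<sigma> n \<delta>) f a"
  shows "is_type \<Delta> B"
proof -
  have fam: "family \<Gamma> A" and kan: "kan_fibration (ext \<Gamma> A) \<Gamma> (\<lambda>n. fst)"
    using A by (auto simp: is_type_def)
  have famS: "family \<Delta> (subst \<sigma> A)" by (rule family_subst[OF \<sigma> fam])
  have famB: "family \<Delta> B"
  proof (rule familyI)
    fix m n f \<delta> a assume *: "\<delta> \<in> splx \<Delta> n" "a \<in> fib B n \<delta>" "f \<in> hom m n"
    note ** = tr_in[OF famS *(1) _ *(3), of a]
    show "tr B n \<delta> f a \<in> fib B m (restr \<Delta> n f \<delta>)"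
      using * ** by (simp add: fib tr restr_in[OF \<Delta>])
    fix k g assume g: "g \<in> hom k m"
    show "tr B m (restr \<Delta> n f \<delta>) g (tr B n \<delta> f a) = tr B n \<delta> (f \<bullet> g) a"
      using * ** g tr_cmp[OF famS *(1) _ *(3) g, of a]
      by (simp add: fib tr restr_in[OF \<Delta>] tr[OF *(1) cmp_hom])
  next
    fix n \<delta> a assume "\<delta> \<in> splx \<Delta> n" "a \<in> fib B n \<delta>"
    then show "tr B n \<delta> (idm n) a = a"
      using tr_idm[OF famS, of \<delta> n a] by (simp add: fib tr[OF _ idm_hom])
  qed
  have "kan_fibration (ext \<Delta> B) \<Delta> (\<lambda>n. fst)"
    unfolding kan_fibration_def
  proof (intro conjI simplicial_map_fst allI impI)
    fix n k :: nat and u v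
    assume n: "1 \<le> n" "k \<le> n" and u: "simplicial_map (horn n k) (ext \<Delta> B) u"
      and v: "simplicial_map (Delta n) \<Delta> v" and uv: "\<forall>m. \<forall>x\<in>splx (horn n k) m. fst (u m x) = v m x"
    define q where "q = (\<lambda>n (\<delta>, b :: 'c). (\<sigma> n \<delta>, b))"
    have q: "simplicial_map (ext \<Delta> B) (ext \<Gamma> A) q"
      by (rule simplicial_mapI)
        (auto simp: q_def fib tr simplicial_map_in[OF \<sigma>] simplicial_map_restr[OF \<sigma>])
    have "\<exists>w. simplicial_map (Delta n) (ext \<Gamma> A) w \<and>
        (\<forall>m. \<forall>x\<in>splx (horn n k) m. w m x = q m (u m x)) \<and>
        (\<forall>m. \<forall>x\<in>splx (Delta n) m. fst (w m x) = \<sigma> m (v m x))"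
      by (rule kan[unfolded kan_fibration_def, THEN conjunct2, rule_format,
            OF n simplicial_map_comp[OF u q] simplicial_map_comp[OF v \<sigma>]])
        (use uv in \<open>simp add: q_def case_prod_unfold\<close>)
    then obtain w where w: "simplicial_map (Delta n) (ext \<Gamma> A) w"
      and wu: "\<And>m x. x \<in> splx (horn n k) m \<Longrightarrow> w m x = q m (u m x)"
      and wv: "\<And>m x. x \<in> hom m n \<Longrightarrow> fst (w m x) = \<sigma> m (v m x)" by auto
    \<comment> \<open>The base coordinate must be \<open>v\<close> itself; \<open>w\<close> only
      lies over its image under \<open>\<sigma>\<close>.\<close>
    define w' where "w' = (\<lambda>m x. (v m x, snd (w m x)))"
    have wfib: "snd (w m x) \<in> fib A m (\<sigma> m (v m x))" if "x \<in> hom m n" for m x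
      using simplicial_map_in[OF w, of x m] wv[OF that] that by (cases "w m x") auto
    have wtr: "snd (w j (x \<bullet> f)) = tr A m (\<sigma> m (v m x)) f (snd (w m x))"
      if "x \<in> hom m n" "f \<in> hom j m" for j m x f
      using simplicial_map_restr[OF w, of x m f j] wv[OF that(1)] that by (cases "w m x") auto
    show "\<exists>w. simplicial_map (Delta n) (ext \<Delta> B) w \<and>
        (\<forall>m. \<forall>x\<in>splx (horn n k) m. w m x = u m x) \<and>
        (\<forall>m. \<forall>x\<in>splx (Delta n) m. fst (w m x) = v m x)"
    proof (intro exI conjI allI ballI)
      show "simplicial_map (Delta n) (ext \<Delta> B) w'"
      proof (rule simplicial_mapI)
        fix m x assume "x \<in> splx (Delta n) m"
        then show "w' m x \<in> splx (ext \<Delta> B) m"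
          using simplicial_map_in[OF v, of x m] wfib by (simp add: w'_def fib)
      next
        fix j m f x assume "x \<in> splx (Delta n) m" "f \<in> hom j m"
        then show "w' j (restr (Delta n) m f x) = restr (ext \<Delta> B) m f (w' m x)"
          using simplicial_map_in[OF v, of x m] simplicial_map_restr[OF v, of x m f j] wfib wtr
          by (simp add: w'_def tr)
      qed
      show "w' m x = u m x" if "x \<in> splx (horn n k) m" for m x
        using wu[OF that] uv that by (simp add: w'_def q_def prod_eq_iff case_prod_unfold)
    qed (simp add: w'_def)
  qed
  with famB show ?thesis by (simp add: is_type_def)
qed

text \<open>By the Yoneda lemma, \<gamma> stands for a map out of \<Delta>[n], and a filler is
  determined by its value at \<open>idm n\<close>. The Kan condition thus becomes a statement about
  elements of fibres, in which the horn is a compatible family \<open>u\<close>.\<close>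

lemma type_horn_filler:
  assumes \<Gamma>: "simplicial_set \<Gamma>" and P: "is_type \<Gamma> P" and \<gamma>: "\<gamma> \<in> splx \<Gamma> n"
    and n: "1 \<le> n" "k \<le> n"
    and u: "\<And>m x. x \<in> splx (horn n k) m \<Longrightarrow> u x \<in> fib P m (restr \<Gamma> n x \<gamma>)"
    and u_nat: "\<And>j m x g. x \<in> splx (horn n k) m \<Longrightarrow> g \<in> hom j m
      \<Longrightarrow> u (x \<bullet> g) = tr P m (restr \<Gamma> n x \<gamma>) g (u x)"
  shows "\<exists>c\<in>fib P n \<gamma>. \<forall>m. \<forall>x\<in>splx (horn n k) m. tr P n \<gamma> x c = u x"
proof -
  define u' where "u' = (\<lambda>m :: nat. \<lambda>x. (restr \<Gamma> n x \<gamma>, u x))"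
  define v where "v = (\<lambda>m :: nat. \<lambda>x. restr \<Gamma> n x \<gamma>)"
  have hh: "x \<in> hom m n" if "x \<in> splx (horn n k) m" for m x
    using that by (simp add: splx_horn)
  have "\<exists>w. simplicial_map (Delta n) (ext \<Gamma> P) w \<and>
        (\<forall>m. \<forall>x\<in>splx (horn n k) m. w m x = u' m x) \<and>
        (\<forall>m. \<forall>x\<in>splx (Delta n) m. fst (w m x) = v m x)"
  proof (rule P[unfolded is_type_def kan_fibration_def, THEN conjunct2, THEN conjunct2, rule_format, OF n])
    show "simplicial_map (horn n k) (ext \<Gamma> P) u'"
      by (rule simplicial_mapI)
        (auto simp: u'_def u u_nat dest!: hh intro: restr_in[OF \<Gamma> \<gamma>] restr_cmp[OF \<Gamma> \<gamma>, symmetric])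
    show "simplicial_map (Delta n) \<Gamma> v"
      by (rule simplicial_mapI)
        (auto simp: v_def restr_in[OF \<Gamma> \<gamma>] restr_cmp[OF \<Gamma> \<gamma>])
  qed (simp add: u'_def v_def)
  then obtain w where w: "simplicial_map (Delta n) (ext \<Gamma> P) w"
    and wu: "\<And>m x. x \<in> splx (horn n k) m \<Longrightarrow> w m x = u' m x"
    and wv: "\<And>m x. x \<in> hom m n \<Longrightarrow> fst (w m x) = v m x" by auto
  define c where "c = snd (w n (idm n))"
  have wc: "w n (idm n) = (\<gamma>, c)"
    using wv[OF idm_hom] by (simp add: c_def v_def restr_idm[OF \<Gamma> \<gamma>] prod_eq_iff)
  show ?thesis
  proof (intro bexI allI ballI)
    show "c \<in> fib P n \<gamma>" using simplicial_map_in[OF w, of "idm n" n] wc by simp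
    fix m x assume x: "x \<in> splx (horn n k) m"
    show "tr P n \<gamma> x c = u x"
      using simplicial_map_restr[OF w, of "idm n" n x m] wu[OF x] hh[OF x] wc
      by (simp add: u'_def)
  qed
qed

section \<open>Propositions with inhabited vertices\<close>

text \<open>\<open>H\<close> is a homotopy between the two projections of \<open>P \<times>\<^sub>\<Gamma> P\<close>.\<close>

definition fibrewise_homotopy ::
    "'g sset \<Rightarrow> ('g, 'p) fam \<Rightarrow> (nat \<Rightarrow> 'g \<Rightarrow> 'p \<Rightarrow> 'p \<Rightarrow> nat list \<Rightarrow> 'p) \<Rightarrow> bool" where
  "fibrewise_homotopy \<Gamma> P H \<longleftrightarrow>
    (\<forall>n. \<forall>\<gamma>\<in>splx \<Gamma> n. \<forall>a\<in>fib P n \<gamma>. \<forall>b\<in>fib P n \<gamma>.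
      (\<forall>t\<in>hom n 1. H n \<gamma> a b t \<in> fib P n \<gamma>) \<and>
      (\<forall>m. \<forall>f\<in>hom m n. \<forall>t\<in>hom n 1.
        H m (restr \<Gamma> n f \<gamma>) (tr P n \<gamma> f a) (tr P n \<gamma> f b) (t \<bullet> f) = tr P n \<gamma> f (H n \<gamma> a b t)) \<and>
      H n \<gamma> a b (replicate (Suc n) 0) = a \<and>
      H n \<gamma> a b (replicate (Suc n) 1) = b)"

section \<open>Coordinates on the prism \<Delta>[n] \<times> \<Delta>[1]\<close>

definition coface :: "nat \<Rightarrow> nat \<Rightarrow> nat" where
  "coface i j = (if j < i then j else Suc j)"

definition codegeneracy :: "nat \<Rightarrow> nat \<Rightarrow> nat" where
  "codegeneracy i j = (if j \<le> i then j else j - 1)"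

text \<open>For \<open>i\<close> from \<open>0\<close> to \<open>n + 1\<close> these give all
  monotone maps from [n] to [1]; \<open>i\<close> is the place of the jump.\<close>

definition heaviside :: "nat \<Rightarrow> nat \<Rightarrow> nat" where
  "heaviside i j = (if j < i then 0 else 1)"

lemma codegeneracy_coface [simp]: "codegeneracy i (coface i j) = j"
  by (auto simp: codegeneracy_def coface_def)

lemma codegeneracy_eqD: "codegeneracy i l = codegeneracy i k \<Longrightarrow> k \<noteq> i \<Longrightarrow> k \<noteq> Suc i \<Longrightarrow> l = k"
  unfolding codegeneracy_def by (split if_split_asm; split if_split_asm; arith)

text \<open>\<open>heaviside (Suc i)\<close> jumps between \<open>i\<close> and
  \<open>Suc i\<close>, the two numbers that \<open>codegeneracy i\<close> identifies. Only
  \<open>Suc i\<close> is carried across the jump.\<close>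

lemma heaviside_codegeneracy: "j \<noteq> Suc i \<Longrightarrow> heaviside (Suc i) (codegeneracy i j) = heaviside (Suc i) j"
  unfolding heaviside_def codegeneracy_def by (cases "j \<le> i") auto

lemma coface_neq [simp]: "coface i j \<noteq> i"
  by (auto simp: coface_def)

lemma map_coface_hom: "x \<in> hom m n \<Longrightarrow> map (coface i) x \<in> hom m (Suc n)"
  by (erule map_hom) (auto simp: coface_def)

lemma map_codegeneracy_hom: "x \<in> hom m (Suc n) \<Longrightarrow> i \<le> n \<Longrightarrow> map (codegeneracy i) x \<in> hom m n"
  by (erule map_hom) (auto simp: codegeneracy_def)

lemma map_heaviside_hom: "x \<in> hom m n \<Longrightarrow> map (heaviside i) x \<in> hom m 1"
  by (erule map_hom) (auto simp: heaviside_def)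

text \<open>A boundary simplex of the \<open>i\<close>-th face misses a second vertex besides
  \<open>i\<close>, which is what membership in the horn without that face demands.\<close>

lemma map_in_splx_horn:
  assumes "x \<in> hom m n" "set x \<noteq> {..n}" "i \<le> n"
  shows "map (coface i) x \<in> splx (horn (Suc n) i) m"
proof -
  obtain j where j: "j \<le> n" "j \<notin> set x"
    using assms(1,2) by (auto simp: hom_def)
  have inj: "coface i a = coface i b \<longleftrightarrow> a = b" for a b
    by (metis codegeneracy_coface)
  have "coface i j \<notin> set (map (coface i) x)" using j inj by auto
  moreover have "coface i j \<le> Suc n" using j by (auto simp: coface_def)
  ultimately show ?thesis
    using map_coface_hom[OF assms(1)] by (auto simp: splx_horn)
qed

text \<open>The homotopy \<open>H\<close> from the boundary of \<open>a\<close> to \<open>s\<close> is extended over the prism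
  \<open>\<Delta>[n] \<times> \<Delta>[1]\<close>, one of its \<open>(n+1)\<close>-simplices at a time. Only the \<open>n\<close>-simplices between
  consecutive ones matter: \<open>c\<close> runs through the lifts of the graphs of \<open>heaviside i\<close>, from \<open>i = n + 1\<close>,
  where it is \<open>a\<close>, down to \<open>i = 0\<close>.\<close>

lemma boundary_filler:
  assumes \<Gamma>: "simplicial_set \<Gamma>" and P: "is_type \<Gamma> P" and H: "fibrewise_homotopy \<Gamma> P H"
    and \<gamma>: "\<gamma> \<in> splx \<Gamma> n" and n: "1 \<le> n"
    and s: "\<And>m f. f \<in> hom m n \<Longrightarrow> set f \<noteq> {..n} \<Longrightarrow> s f \<in> fib P m (restr \<Gamma> n f \<gamma>)"
    and s_nat: "\<And>j m f g. f \<in> hom m n \<Longrightarrow> set f \<noteq> {..n} \<Longrightarrow> g \<in> hom j m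
      \<Longrightarrow> s (f \<bullet> g) = tr P m (restr \<Gamma> n f \<gamma>) g (s f)"
  shows "\<exists>c\<in>fib P n \<gamma>. \<forall>m. \<forall>f\<in>hom m n. set f \<noteq> {..n} \<longrightarrow> tr P n \<gamma> f c = s f"
proof -
  note fam = is_type_family[OF P]
  have H_in: "H n \<gamma> a b t \<in> fib P n \<gamma>"
    if "\<gamma> \<in> splx \<Gamma> n" "a \<in> fib P n \<gamma>" "b \<in> fib P n \<gamma>" "t \<in> hom n 1" for n \<gamma> a b t
    using H that by (simp add: fibrewise_homotopy_def)
  have H_nat: "tr P n \<gamma> f (H n \<gamma> a b t) =
      H m (restr \<Gamma> n f \<gamma>) (tr P n \<gamma> f a) (tr P n \<gamma> f b) (t \<bullet> f)"
    if "\<gamma> \<in> splx \<Gamma> n" "a \<in> fib P n \<gamma>" "b \<in> fib P n \<gamma>" "t \<in> hom n 1" "f \<in> hom m n" for m n \<gamma> a b t f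
    using H that by (simp add: fibrewise_homotopy_def)
  have H_end: "H n \<gamma> a b (replicate (Suc n) 0) = a" "H n \<gamma> a b (replicate (Suc n) 1) = b"
    if "\<gamma> \<in> splx \<Gamma> n" "a \<in> fib P n \<gamma>" "b \<in> fib P n \<gamma>" for n \<gamma> a b
    using H that unfolding fibrewise_homotopy_def by blast+
  \<comment> \<open>Any point of the fibre will do, and the choice of the horn at \<open>0\<close>
    is arbitrary. The filler need not agree with \<open>s\<close> on the remaining face:
    \<open>K\<close> is a homotopy over the whole boundary of \<Delta>[n] that leads from the
    boundary of \<open>a\<close> to \<open>s\<close>.\<close>
  have "\<exists>a\<in>fib P n \<gamma>. \<forall>m. \<forall>x\<in>splx (horn n 0) m. tr P n \<gamma> x a = s x"
  proof (rule type_horn_filler[OF \<Gamma> P \<gamma> n])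
    fix m x assume x: "x \<in> splx (horn n 0) m"
    then have x': "x \<in> hom m n" "set x \<noteq> {..n}" by (auto simp: splx_horn)
    show "s x \<in> fib P m (restr \<Gamma> n x \<gamma>)" by (rule s[OF x'])
    show "s (x \<bullet> g) = tr P m (restr \<Gamma> n x \<gamma>) g (s x)" if "g \<in> hom j m" for j g
      by (rule s_nat[OF x' that])
  qed simp
  then obtain a where a: "a \<in> fib P n \<gamma>" by blast
  define K where "K = (\<lambda>f. H (src f) (restr \<Gamma> n f \<gamma>) (tr P n \<gamma> f a) (s f))"
  have K_in: "K f t \<in> fib P m (restr \<Gamma> n f \<gamma>)"
    if "f \<in> hom m n" "set f \<noteq> {..n}" "t \<in> hom m 1" for f t m
    unfolding K_def src_hom[OF that(1)]
    by (intro H_in restr_in[OF \<Gamma> \<gamma>] tr_in[OF fam \<gamma> a] s that)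
  have K_nat: "K (f \<bullet> g) (t \<bullet> g) = tr P m (restr \<Gamma> n f \<gamma>) g (K f t)"
    if f: "f \<in> hom m n" "set f \<noteq> {..n}" and t: "t \<in> hom m 1" and g: "g \<in> hom j m" for f t m g j
    unfolding K_def src_hom[OF f(1)] src_hom[OF cmp_hom[OF f(1) g]]
    by (simp only: H_nat[OF restr_in[OF \<Gamma> \<gamma> f(1)] tr_in[OF fam \<gamma> a f(1)] s[OF f] t g]
        restr_cmp[OF \<Gamma> \<gamma> f(1) g] tr_cmp[OF fam \<gamma> a f(1) g] s_nat[OF f g])
  have "\<exists>c\<in>fib P n \<gamma>. \<forall>m. \<forall>f\<in>hom m n. set f \<noteq> {..n} \<longrightarrow> tr P n \<gamma> f c = K f (map (heaviside i) f)"
    if "i \<le> Suc n" for i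
    using that
  proof (induction rule: inc_induct)
    case base
    have "K f (map (heaviside (Suc n)) f) = tr P n \<gamma> f a" if f: "f \<in> hom m n" "set f \<noteq> {..n}" for m f
    proof -
      have "map (heaviside (Suc n)) f = replicate (Suc m) 0"
        using f by (auto simp: heaviside_def hom_iff_nth list_eq_iff_nth_eq less_Suc_eq_le simp del: replicate_Suc)
      then show ?thesis
        unfolding K_def src_hom[OF f(1)]
        using H_end(1)[OF restr_in[OF \<Gamma> \<gamma> f(1)] tr_in[OF fam \<gamma> a f(1)] s[OF f]] by simp
    qed
    with a show ?case by auto
  next
    case (step i)
    then have i: "i \<le> n" by simp
    from step.IH obtain c where c: "c \<in> fib P n \<gamma>" and
      cK: "\<And>m f. f \<in> hom m n \<Longrightarrow> set f \<noteq> {..n} \<Longrightarrow> tr P n \<gamma> f c = K f (map (heaviside (Suc i)) f)"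
      by blast
    \<comment> \<open>The prism simplex with vertices (0,0), ..., (i,0), (i,1), ..., (n,1) has the
      projections \<open>\<sigma>\<close> and \<open>heaviside (Suc i)\<close>. Its face opposite
      \<open>Suc i\<close> is the graph of \<open>heaviside (Suc i)\<close> and carries the known
      \<open>c\<close>; its face opposite \<open>i\<close>, included by \<open>\<delta>\<close>, is
      the graph of \<open>heaviside i\<close>.\<close>
    define \<sigma> where "\<sigma> = map (codegeneracy i) (idm (Suc n))"
    define \<delta> where "\<delta> = map (coface i) (idm n)"
    have \<sigma>: "\<sigma> \<in> hom (Suc n) n" unfolding \<sigma>_def by (rule map_codegeneracy_hom[OF idm_hom i])
    have \<delta>: "\<delta> \<in> hom n (Suc n)" unfolding \<delta>_def by (rule map_coface_hom[OF idm_hom])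
    have \<sigma>_cmp: "\<sigma> \<bullet> x = map (codegeneracy i) x" if "x \<in> hom m (Suc n)" for m x
      unfolding \<sigma>_def by (rule map_idm_cmp[OF that])
    have \<delta>_cmp: "\<delta> \<bullet> x = map (coface i) x" if "x \<in> hom m n" for m x
      unfolding \<delta>_def by (rule map_idm_cmp[OF that])
    have \<sigma>\<delta>: "\<sigma> \<bullet> \<delta> = idm n"
      unfolding \<sigma>_cmp[OF \<delta>] by (simp add: \<delta>_def comp_def)
    have \<gamma>\<sigma>: "restr \<Gamma> n \<sigma> \<gamma> \<in> splx \<Gamma> (Suc n)" by (rule restr_in[OF \<Gamma> \<gamma> \<sigma>])
    \<comment> \<open>The horn at \<open>i\<close> consists of faces over the boundary of
      \<Delta>[n], where \<open>K\<close> prescribes the value, and of the face opposite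
      \<open>Suc i\<close>, which \<open>\<sigma>\<close> maps onto \<Delta>[n] and where
      \<open>c\<close> prescribes it.\<close>
    define u where "u = (\<lambda>x. if set (\<sigma> \<bullet> x) \<noteq> {..n} then K (\<sigma> \<bullet> x) (map (heaviside (Suc i)) x)
      else tr P n \<gamma> (\<sigma> \<bullet> x) c)"
    have "\<exists>d\<in>fib P (Suc n) (restr \<Gamma> n \<sigma> \<gamma>). \<forall>m. \<forall>x\<in>splx (horn (Suc n) i) m.
        tr P (Suc n) (restr \<Gamma> n \<sigma> \<gamma>) x d = u x"
    proof (rule type_horn_filler[OF \<Gamma> P \<gamma>\<sigma>])
      fix m x assume x: "x \<in> splx (horn (Suc n) i) m"
      then have xh: "x \<in> hom m (Suc n)" by (simp add: splx_horn)
      have \<sigma>x: "\<sigma> \<bullet> x \<in> hom m n" using \<sigma> xh by blast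
      have tx: "map (heaviside (Suc i)) x \<in> hom m 1" using map_heaviside_hom[OF xh] .
      show "u x \<in> fib P m (restr \<Gamma> (Suc n) x (restr \<Gamma> n \<sigma> \<gamma>))"
        unfolding restr_cmp[OF \<Gamma> \<gamma> \<sigma> xh] u_def
        using K_in[OF \<sigma>x _ tx] tr_in[OF fam \<gamma> c \<sigma>x] by simp
      fix j g assume g: "g \<in> hom j m"
      have xgh: "x \<bullet> g \<in> hom j (Suc n)" using xh g by blast
      have assoc: "\<sigma> \<bullet> (x \<bullet> g) = (\<sigma> \<bullet> x) \<bullet> g" using cmp_assoc[OF xh g] by simp
      show "u (x \<bullet> g) = tr P m (restr \<Gamma> (Suc n) x (restr \<Gamma> n \<sigma> \<gamma>)) g (u x)"
      proof (cases "set (\<sigma> \<bullet> x) = {..n}")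
        case False
        then show ?thesis
          unfolding restr_cmp[OF \<Gamma> \<gamma> \<sigma> xh] u_def assoc
          using set_cmp_proper[OF \<sigma>x False g] K_nat[OF \<sigma>x False tx g] by (simp add: map_cmp[OF xh g])
      next
        case True
        \<comment> \<open>\<open>codegeneracy i\<close> identifies only \<open>i\<close> and
          \<open>Suc i\<close>, so a missed vertex other than these two would give a number missed
          by the projection. Hence a horn simplex that projects onto \<Delta>[n] lies in the face
          opposite \<open>Suc i\<close>.\<close>
        have miss: "Suc i \<notin> set x"
        proof
          assume *: "Suc i \<in> set x"
          obtain k where k: "k \<le> Suc n" "k \<noteq> i" "k \<notin> set x" using x by (auto simp: splx_horn)
          with * have "k \<noteq> Suc i" by auto
          have "codegeneracy i k \<in> set (\<sigma> \<bullet> x)"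
            unfolding True using k i by (auto simp: codegeneracy_def)
          then obtain l where "l \<in> set x" "codegeneracy i l = codegeneracy i k"
            unfolding \<sigma>_cmp[OF xh] by auto
          with k \<open>k \<noteq> Suc i\<close> show False using codegeneracy_eqD by blast
        qed
        have "tr P m (restr \<Gamma> (Suc n) x (restr \<Gamma> n \<sigma> \<gamma>)) g (u x) = tr P n \<gamma> ((\<sigma> \<bullet> x) \<bullet> g) c"
          unfolding restr_cmp[OF \<Gamma> \<gamma> \<sigma> xh] u_def using True tr_cmp[OF fam \<gamma> c \<sigma>x g] by simp
        also have "\<dots> = u (x \<bullet> g)"
        proof (cases "set ((\<sigma> \<bullet> x) \<bullet> g) = {..n}")
          case True
          then show ?thesis unfolding u_def assoc by simp
        next
          case False
          \<comment> \<open>Here the two prescriptions have to agree. Since \<open>Suc i\<close> is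
            missed, the coordinate in \<Delta>[1] can be read off the projection to \<Delta>[n], and
            \<open>cK\<close> applies.\<close>
          have "map (heaviside (Suc i)) ((\<sigma> \<bullet> x) \<bullet> g) = map (heaviside (Suc i)) (x \<bullet> g)"
            unfolding assoc[symmetric] \<sigma>_cmp[OF xgh]
            using miss set_cmp_subset[OF xh g] by (auto intro!: heaviside_codegeneracy)
          then show ?thesis
            unfolding u_def assoc using False cK[OF cmp_hom[OF \<sigma>x g] False] by simp
        qed
        finally show ?thesis by simp
      qed
    qed (use i in auto)
    then obtain d where d: "d \<in> fib P (Suc n) (restr \<Gamma> n \<sigma> \<gamma>)" and
      du: "\<And>m x. x \<in> splx (horn (Suc n) i) m \<Longrightarrow> tr P (Suc n) (restr \<Gamma> n \<sigma> \<gamma>) x d = u x" by blast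
    have face: "restr \<Gamma> (Suc n) \<delta> (restr \<Gamma> n \<sigma> \<gamma>) = \<gamma>"
      using restr_cmp[OF \<Gamma> \<gamma> \<sigma> \<delta>] restr_idm[OF \<Gamma> \<gamma>] \<sigma>\<delta> by simp
    \<comment> \<open>This is the face that the horn leaves out. On it
      \<open>heaviside (Suc i)\<close> composed with \<open>coface i\<close> is
      \<open>heaviside i\<close>, which lowers the index by one.\<close>
    define c' where "c' = tr P (Suc n) (restr \<Gamma> n \<sigma> \<gamma>) \<delta> d"
    have c': "c' \<in> fib P n \<gamma>"
      using tr_in[OF fam \<gamma>\<sigma> d \<delta>] unfolding face c'_def .
    have "tr P n \<gamma> f c' = K f (map (heaviside i) f)" if f: "f \<in> hom m n" "set f \<noteq> {..n}" for m f
    proof -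
      have \<delta>f: "\<delta> \<bullet> f \<in> splx (horn (Suc n) i) m"
        unfolding \<delta>_cmp[OF f(1)] by (rule map_in_splx_horn[OF f i])
      have \<sigma>\<delta>f: "\<sigma> \<bullet> (\<delta> \<bullet> f) = f"
        using cmp_assoc[OF \<delta> f(1), of \<sigma>] \<sigma>\<delta> f(1) by simp
      have "tr P n \<gamma> f c' = tr P (Suc n) (restr \<Gamma> n \<sigma> \<gamma>) (\<delta> \<bullet> f) d"
        using tr_cmp[OF fam \<gamma>\<sigma> d \<delta> f(1)] unfolding face c'_def .
      also have "\<dots> = K f (map (heaviside (Suc i)) (\<delta> \<bullet> f))"
        unfolding du[OF \<delta>f] u_def \<sigma>\<delta>f using f(2) by simp
      also have "map (heaviside (Suc i)) (\<delta> \<bullet> f) = map (heaviside i) f"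
        unfolding \<delta>_cmp[OF f(1)] by (auto simp: heaviside_def coface_def)
      finally show ?thesis .
    qed
    with c' show ?case by blast
  qed
  from this[of 0] obtain c where c: "c \<in> fib P n \<gamma>" and
    cK: "\<And>m f. f \<in> hom m n \<Longrightarrow> set f \<noteq> {..n} \<Longrightarrow> tr P n \<gamma> f c = K f (map (heaviside 0) f)" by auto
  have "K f (map (heaviside 0) f) = s f" if f: "f \<in> hom m n" "set f \<noteq> {..n}" for m f
  proof -
    have "map (heaviside 0) f = replicate (Suc m) 1"
      using f by (auto simp: heaviside_def hom_iff_nth list_eq_iff_nth_eq less_Suc_eq_le simp del: replicate_Suc)
    then show ?thesis
      unfolding K_def src_hom[OF f(1)]
      using H_end(2)[OF restr_in[OF \<Gamma> \<gamma> f(1)] tr_in[OF fam \<gamma> a f(1)] s[OF f]] by simp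
  qed
  with c cK show ?thesis by metis
qed

text \<open>Any choice of preimages under a monotone surjection is itself monotone, so one of them
  can be prescribed. Prescribing \<open>d ! (f ! i) = i\<close> allows another map to be compared
  with \<open>f\<close> at \<open>i\<close>.\<close>

lemma surjective_section:
  assumes f: "f \<in> hom m n" "set f = {..n}" and i: "i \<le> m"
  obtains d where "d \<in> hom n m" "f \<bullet> d = idm n" "d ! (f ! i) = i"
proof -
  have "\<exists>l\<le>m. f ! l = j \<and> (j = f ! i \<longrightarrow> l = i)" if "j \<le> n" for j
  proof (cases "j = f ! i")
    case False
    have "j \<in> set f" using f(2) that by simp
    then show ?thesis using False length_hom[OF f(1)] by (auto simp: in_set_conv_nth less_Suc_eq_le)
  qed (use i in auto)
  then obtain D where D: "\<And>j. j \<le> n \<Longrightarrow> D j \<le> m \<and> f ! D j = j \<and> (j = f ! i \<longrightarrow> D j = i)"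
    by metis
  have mono: "D j \<le> D k" if "j \<le> k" "k \<le> n" for j k
  proof (rule ccontr)
    assume *: "\<not> D j \<le> D k"
    have "j \<le> n" using that by simp
    then have "D k \<le> D j" "D j \<le> m" using * D by auto
    then have "f ! D k \<le> f ! D j" using f(1) by (simp add: hom_iff_nth)
    with D[OF \<open>j \<le> n\<close>] D[OF that(2)] that(1) have "j = k" by simp
    with * show False by simp
  qed
  have d: "map D (idm n) \<in> hom n m" by (rule map_hom[OF idm_hom]) (use D mono in auto)
  moreover have "f \<bullet> map D (idm n) = idm n"
    using D by (auto simp: cmp_def idm_def less_Suc_eq_le simp del: upt_Suc intro!: map_idI)
  moreover have "map D (idm n) ! (f ! i) = i"
    using D nth_hom_le[OF f(1) i] by (simp add: idm_def less_Suc_eq_le del: upt_Suc)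
  ultimately show ?thesis by (rule that)
qed

text \<open>\<open>codegeneracy i\<close> inverts \<open>coface i\<close> away from a missed value
  \<open>i\<close>. Thus a partial section defined in dimension \<open>n - 1\<close> is defined on
  the boundary of every \<open>n\<close>-simplex.\<close>

lemma proper_factor:
  assumes f: "f \<in> hom m n" "set f \<noteq> {..n}"
  obtains g h where "1 \<le> n" "g \<in> hom (n - 1) n" "h \<in> hom m (n - 1)" "f = g \<bullet> h"
proof -
  obtain i where i: "i \<le> n" "i \<notin> set f" using f by (auto simp: hom_def)
  have n: "1 \<le> n"
  proof (rule ccontr)
    assume "\<not> 1 \<le> n"
    then have "n = 0" by simp
    with f(1) have "f = replicate (Suc m) 0" by (simp add: hom_0_iff del: replicate_Suc)
    with i \<open>n = 0\<close> show False by simp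
  qed
  have nth: "f ! l \<noteq> i" if "l \<le> m" for l
    using i(2) length_hom[OF f(1)] that by (metis nth_mem less_Suc_eq_le)
  have h: "map (codegeneracy i) f \<in> hom m (n - 1)"
    unfolding hom_iff_nth
  proof (intro conjI allI impI)
    show "length (map (codegeneracy i) f) = Suc m" using f(1) by (simp add: length_hom)
    fix l assume "l \<le> m"
    then show "map (codegeneracy i) f ! l \<le> n - 1"
      using nth[of l] nth_hom_le[OF f(1), of l] i(1) length_hom[OF f(1)] n by (auto simp: codegeneracy_def)
    fix k assume "k \<le> l"
    then have "f ! k \<le> f ! l" using f(1) \<open>l \<le> m\<close> by (simp add: hom_iff_nth)
    then show "map (codegeneracy i) f ! k \<le> map (codegeneracy i) f ! l"
      using \<open>k \<le> l\<close> \<open>l \<le> m\<close> length_hom[OF f(1)] by (auto simp: codegeneracy_def)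
  qed
  have g: "map (coface i) (idm (n - 1)) \<in> hom (n - 1) n"
    using map_coface_hom[OF idm_hom, of i "n - 1"] n by simp
  have "map (coface i) (idm (n - 1)) \<bullet> map (codegeneracy i) f = map (coface i) (map (codegeneracy i) f)"
    by (rule map_idm_cmp[OF h])
  also have "\<dots> = f"
    using i(2) by (auto simp: coface_def codegeneracy_def intro!: map_idI)
  finally show ?thesis using that[OF n g h] by simp
qed

text \<open>The graph of a section over a simplicial subset of \<Gamma>. With graphs, extension is
  inclusion, and the natural upper bound of a chain is its union.\<close>

definition partial_section :: "'g sset \<Rightarrow> ('g, 'p) fam \<Rightarrow> (nat \<times> 'g \<times> 'p) set \<Rightarrow> bool" where
  "partial_section \<Gamma> P G \<longleftrightarrow>
    (\<forall>n \<gamma> a. (n, \<gamma>, a) \<in> G \<longrightarrow> \<gamma> \<in> splx \<Gamma> n \<and> a \<in> fib P n \<gamma>) \<and>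
    (\<forall>n \<gamma> a b. (n, \<gamma>, a) \<in> G \<longrightarrow> (n, \<gamma>, b) \<in> G \<longrightarrow> a = b) \<and>
    (\<forall>m n \<gamma> a f. (n, \<gamma>, a) \<in> G \<longrightarrow> f \<in> hom m n \<longrightarrow> (m, restr \<Gamma> n f \<gamma>, tr P n \<gamma> f a) \<in> G)"

text \<open>Every condition involves at most two elements of the graph, and any two elements of the
  union of a chain lie in a common member. The empty chain is bounded by the empty section.\<close>

lemma ex_maximal_partial_section:
  "\<exists>G. partial_section \<Gamma> P G \<and> (\<forall>G'. partial_section \<Gamma> P G' \<longrightarrow> G \<subseteq> G' \<longrightarrow> G' = G)"
proof -
  have "\<exists>G\<in>Collect (partial_section \<Gamma> P). \<forall>G'\<in>Collect (partial_section \<Gamma> P). G \<subseteq> G' \<longrightarrow> G' = G"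
  proof (rule subset_Zorn')
    fix C assume C: "subset.chain (Collect (partial_section \<Gamma> P)) C"
    then have C': "\<And>G. G \<in> C \<Longrightarrow> partial_section \<Gamma> P G"
      by (auto simp: subset.chain_def)
    have dir: "\<exists>G\<in>C. x \<in> G \<and> y \<in> G" if "x \<in> \<Union>C" "y \<in> \<Union>C" for x y
    proof -
      obtain G G' where "G \<in> C" "x \<in> G" "G' \<in> C" "y \<in> G'" using \<open>x \<in> \<Union>C\<close> \<open>y \<in> \<Union>C\<close> by blast
      moreover from this have "G \<subseteq> G' \<or> G' \<subseteq> G" using C by (auto simp: subset_chain_def)
      ultimately show ?thesis by blast
    qed
    have "partial_section \<Gamma> P (\<Union>C)"
      unfolding partial_section_def
    proof (intro conjI allI impI)
      fix n \<gamma> a assume "(n, \<gamma>, a) \<in> \<Union>C"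
      then obtain G where G: "G \<in> C" "(n, \<gamma>, a) \<in> G" by blast
      note ps = C'[OF G(1), unfolded partial_section_def]
      show "\<gamma> \<in> splx \<Gamma> n" "a \<in> fib P n \<gamma>" using ps G(2) by blast+
      fix m f assume "f \<in> hom m n"
      with ps G have "(m, restr \<Gamma> n f \<gamma>, tr P n \<gamma> f a) \<in> G" by blast
      with G(1) show "(m, restr \<Gamma> n f \<gamma>, tr P n \<gamma> f a) \<in> \<Union>C" by blast
    next
      fix n \<gamma> a b assume "(n, \<gamma>, a) \<in> \<Union>C" "(n, \<gamma>, b) \<in> \<Union>C"
      from dir[OF this] obtain G where "G \<in> C" "(n, \<gamma>, a) \<in> G" "(n, \<gamma>, b) \<in> G" by blast
      with C'[OF this(1), unfolded partial_section_def] show "a = b" by blast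
    qed
    then show "\<Union>C \<in> Collect (partial_section \<Gamma> P)" by simp
  qed
  then show ?thesis by auto
qed

text \<open>A maximal partial section is total: otherwise it is undefined at some simplex \<open>\<gamma>\<close> of least
  dimension, but defined on the boundary of \<open>\<gamma>\<close>. Then \<open>\<gamma>\<close> is nondegenerate, so that distinct
  surjections give distinct degeneracies of \<open>\<gamma>\<close>, and any filler of the boundary extends the section.\<close>

lemma ex_section_of_homotopy:
  assumes \<Gamma>: "simplicial_set \<Gamma>" and P: "is_type \<Gamma> P" and H: "fibrewise_homotopy \<Gamma> P H"
    and vertices: "\<And>\<gamma>. \<gamma> \<in> splx \<Gamma> 0 \<Longrightarrow> fib P 0 \<gamma> \<noteq> {}"
  shows "\<exists>s. is_term \<Gamma> P s"
proof -
  note fam = is_type_family[OF P]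
  obtain G where G: "partial_section \<Gamma> P G"
    and G_max: "\<And>G'. partial_section \<Gamma> P G' \<Longrightarrow> G \<subseteq> G' \<Longrightarrow> G' = G"
    using ex_maximal_partial_section[of \<Gamma> P] by blast
  have G_in: "\<gamma> \<in> splx \<Gamma> n" "a \<in> fib P n \<gamma>" if "(n, \<gamma>, a) \<in> G" for n \<gamma> a
    using G that unfolding partial_section_def by blast+
  have G_fun: "a = b" if "(n, \<gamma>, a) \<in> G" "(n, \<gamma>, b) \<in> G" for n \<gamma> a b
    using G that unfolding partial_section_def by blast
  have G_restr: "(m, restr \<Gamma> n f \<gamma>, tr P n \<gamma> f a) \<in> G" if "(n, \<gamma>, a) \<in> G" "f \<in> hom m n" for n \<gamma> a m f
    using G that unfolding partial_section_def by blast
  have total: "\<exists>a. (n, \<gamma>, a) \<in> G" if "\<gamma> \<in> splx \<Gamma> n" for n \<gamma>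
    using that
  proof (induction n arbitrary: \<gamma> rule: less_induct)
    case (less n)
    note \<gamma> = less.prems
    show ?case
    proof (rule ccontr)
      assume undef: "\<nexists>a. (n, \<gamma>, a) \<in> G"
      have bdry: "\<exists>a. (m, restr \<Gamma> n f \<gamma>, a) \<in> G" if f: "f \<in> hom m n" "set f \<noteq> {..n}" for m f
      proof -
        obtain g h where gh: "1 \<le> n" "g \<in> hom (n - 1) n" "h \<in> hom m (n - 1)" "f = g \<bullet> h"
          by (rule proper_factor[OF f])
        obtain a where "(n - 1, restr \<Gamma> n g \<gamma>, a) \<in> G"
          using less.IH[OF _ restr_in[OF \<Gamma> \<gamma> gh(2)]] gh(1) by auto
        from G_restr[OF this gh(3)] show ?thesis
          unfolding restr_cmp[OF \<Gamma> \<gamma> gh(2,3)] gh(4) by blast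
      qed
      define s where "s = (\<lambda>f. THE a. (src f, restr \<Gamma> n f \<gamma>, a) \<in> G)"
      have sG: "(m, restr \<Gamma> n f \<gamma>, s f) \<in> G" if f: "f \<in> hom m n" "set f \<noteq> {..n}" for m f
        unfolding s_def src_hom[OF f(1)] by (rule theI') (use bdry[OF f] G_fun in blast)
      have "\<exists>c\<in>fib P n \<gamma>. \<forall>m. \<forall>f\<in>hom m n. set f \<noteq> {..n} \<longrightarrow> tr P n \<gamma> f c = s f"
      proof (cases "n = 0")
        case True
        \<comment> \<open>\<Delta>[0] has empty boundary, so any element of the fibre is a filler; a
          homotopy cannot produce one, and the hypothesis on vertices does.\<close>
        have "set f = {..n}" if "f \<in> hom m n" for m f
          using that True by (auto simp: hom_0_iff)
        with vertices[of \<gamma>] \<gamma> True show ?thesis by blast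
      next
        case False
        show ?thesis
        proof (rule boundary_filler[OF \<Gamma> P H \<gamma>])
          fix m f assume f: "f \<in> hom m n" "set f \<noteq> {..n}"
          show "s f \<in> fib P m (restr \<Gamma> n f \<gamma>)" by (rule G_in[OF sG[OF f]])
          fix j g assume g: "g \<in> hom j m"
          have fg: "f \<bullet> g \<in> hom j n" "set (f \<bullet> g) \<noteq> {..n}"
            using f(1) g set_cmp_proper[OF f g] by blast+
          show "s (f \<bullet> g) = tr P m (restr \<Gamma> n f \<gamma>) g (s f)"
            using G_fun[OF sG[OF fg]] G_restr[OF sG[OF f] g] restr_cmp[OF \<Gamma> \<gamma> f(1) g] by simp
        qed (use False in simp)
      qed
      then obtain c where c: "c \<in> fib P n \<gamma>"
        and cs: "\<And>m f. f \<in> hom m n \<Longrightarrow> set f \<noteq> {..n} \<Longrightarrow> tr P n \<gamma> f c = s f" by blast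
      have cG: "(m, restr \<Gamma> n f \<gamma>, tr P n \<gamma> f c) \<in> G" if "f \<in> hom m n" "set f \<noteq> {..n}" for m f
        using sG[OF that] cs[OF that] by simp
      \<comment> \<open>A value at a degeneracy of \<gamma>, restricted along a section
        \<open>d\<close> of the surjection, would be a value at \<gamma>.\<close>
      have new: "(m, restr \<Gamma> n f \<gamma>, b) \<notin> G" if f: "f \<in> hom m n" "set f = {..n}" for m f b
      proof
        assume *: "(m, restr \<Gamma> n f \<gamma>, b) \<in> G"
        obtain d where "d \<in> hom n m" "f \<bullet> d = idm n" by (rule surjective_section[OF f, of 0]) auto
        with G_restr[OF * this(1)] restr_cmp[OF \<Gamma> \<gamma> f(1) this(1)] restr_idm[OF \<Gamma> \<gamma>] undef
        show False by auto
      qed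
      \<comment> \<open>\<open>f' \<bullet> d\<close> fixes \<gamma>, so it cannot lie in the
        boundary, where the section is defined. As a surjective monotone endomap of [n] it is the
        identity. Since \<open>d\<close> passes through \<open>i\<close>, evaluation at
        \<open>f ! i\<close> gives \<open>f ! i = f' ! i\<close>.\<close>
      have inj: "f = f'" if f: "f \<in> hom m n" "set f = {..n}" and f': "f' \<in> hom m n"
        and eq: "restr \<Gamma> n f \<gamma> = restr \<Gamma> n f' \<gamma>" for m f f'
      proof (rule nth_equalityI)
        show "length f = length f'" using f(1) f' by (simp add: length_hom)
        fix i assume "i < length f"
        then have i: "i \<le> m" using f(1) by (simp add: length_hom)
        obtain d where d: "d \<in> hom n m" "f \<bullet> d = idm n" "d ! (f ! i) = i"
          by (rule surjective_section[OF f i])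
        have e: "f' \<bullet> d \<in> hom n n" using f' d(1) by blast
        have stable: "restr \<Gamma> n (f' \<bullet> d) \<gamma> = \<gamma>"
          using restr_cmp[OF \<Gamma> \<gamma> f(1) d(1)] restr_cmp[OF \<Gamma> \<gamma> f' d(1)] eq d(2) restr_idm[OF \<Gamma> \<gamma>] by simp
        have surj: "set (f' \<bullet> d) = {..n}"
        proof (rule ccontr)
          assume "set (f' \<bullet> d) \<noteq> {..n}"
          from bdry[OF e this] undef show False unfolding stable by blast
        qed
        have len: "length (f' \<bullet> d) = Suc n" using e by (rule length_hom)
        have "distinct (f' \<bullet> d)" by (rule card_distinct) (simp add: surj len)
        moreover have "sorted (f' \<bullet> d)" using e by (simp add: hom_def)
        ultimately have "f' \<bullet> d = idm n"
          by (intro sorted_distinct_set_unique) (auto simp: surj idm_def atMost_atLeast0 atLeastLessThanSuc_atLeastAtMost simp del: upt_Suc)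
        then have "(f' \<bullet> d) ! (f ! i) = f ! i"
          using nth_hom_le[OF f(1) i] by (simp add: idm_def less_Suc_eq_le del: upt_Suc)
        moreover have "f ! i < length d" using nth_hom_le[OF f(1) i] length_hom[OF d(1)] by simp
        ultimately show "f ! i = f' ! i" by (simp add: cmp_nth d(3))
      qed
      \<comment> \<open>The value \<open>c\<close> at \<gamma> forces the values at all restrictions
        of \<gamma>. Only those along surjections are new; the others lie in \<open>G\<close>
        already by \<open>cG\<close>.\<close>
      define N where "N = {(m, restr \<Gamma> n f \<gamma>, tr P n \<gamma> f c) | m f. f \<in> hom m n}"
      have "partial_section \<Gamma> P (G \<union> N)"
        unfolding partial_section_def
      proof (intro conjI allI impI)
        fix m \<delta> a assume x: "(m, \<delta>, a) \<in> G \<union> N"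
        show "\<delta> \<in> splx \<Gamma> m" "a \<in> fib P m \<delta>"
          using x G_in restr_in[OF \<Gamma> \<gamma>] tr_in[OF fam \<gamma> c] by (auto simp: N_def)
        show "a = b" if y: "(m, \<delta>, b) \<in> G \<union> N" for b
        proof (cases "(m, \<delta>, a) \<in> G \<or> (m, \<delta>, b) \<in> G")
          case True
          \<comment> \<open>By \<open>new\<close>, no surjection restricts \<gamma> to
            \<open>\<delta>\<close> when \<open>G\<close> has a value there, so \<open>e\<close>
            comes from the boundary.\<close>
          have "(m, \<delta>, e) \<in> G" if e: "(m, \<delta>, e) \<in> N" for e
          proof -
            obtain f where f: "f \<in> hom m n" "\<delta> = restr \<Gamma> n f \<gamma>" "e = tr P n \<gamma> f c"
              using e by (auto simp: N_def)
            then show ?thesis using cG[OF f(1)] new[OF f(1)] True by metis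
          qed
          then show ?thesis using x y G_fun by blast
        next
          case False
          then obtain f f' where f: "f \<in> hom m n" "\<delta> = restr \<Gamma> n f \<gamma>" "a = tr P n \<gamma> f c"
            and f': "f' \<in> hom m n" "\<delta> = restr \<Gamma> n f' \<gamma>" "b = tr P n \<gamma> f' c"
            using x y by (auto simp: N_def)
          have "set f = {..n}" using False f cG by metis
          from inj[OF f(1) this f'(1)] f f' show ?thesis by simp
        qed
        fix k g assume g: "g \<in> hom k m"
        from x show "(k, restr \<Gamma> m g \<delta>, tr P m \<delta> g a) \<in> G \<union> N"
        proof
          assume "(m, \<delta>, a) \<in> G" then show ?thesis using G_restr g by blast
        next
          assume "(m, \<delta>, a) \<in> N"
          then obtain f where f: "f \<in> hom m n" "\<delta> = restr \<Gamma> n f \<gamma>" "a = tr P n \<gamma> f c"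
            by (auto simp: N_def)
          have "(k, restr \<Gamma> n (f \<bullet> g) \<gamma>, tr P n \<gamma> (f \<bullet> g) c) \<in> N"
            using f(1) g unfolding N_def by blast
          then show ?thesis
            unfolding f restr_cmp[OF \<Gamma> \<gamma> f(1) g] tr_cmp[OF fam \<gamma> c f(1) g] by blast
        qed
      qed
      from G_max[OF this] have "N \<subseteq> G" by blast
      moreover have "(n, \<gamma>, c) \<in> N"
        unfolding N_def using restr_idm[OF \<Gamma> \<gamma>] tr_idm[OF fam \<gamma> c] idm_hom[of n]
        by (smt (verit) mem_Collect_eq)
      ultimately show False using undef by blast
    qed
  qed
  define s where "s = (\<lambda>n \<gamma>. THE a. (n, \<gamma>, a) \<in> G)"
  have sG: "(n, \<gamma>, s n \<gamma>) \<in> G" if "\<gamma> \<in> splx \<Gamma> n" for n \<gamma>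
    unfolding s_def by (rule theI') (use total[OF that] G_fun in blast)
  have "is_term \<Gamma> P s"
  proof (rule is_termI)
    fix n \<gamma> assume \<gamma>: "\<gamma> \<in> splx \<Gamma> n"
    show "s n \<gamma> \<in> fib P n \<gamma>" by (rule G_in[OF sG[OF \<gamma>]])
    fix m f assume f: "f \<in> hom m n"
    show "s m (restr \<Gamma> n f \<gamma>) = tr P n \<gamma> f (s n \<gamma>)"
      by (rule G_fun[OF sG[OF restr_in[OF \<Gamma> \<gamma> f]] G_restr[OF sG[OF \<gamma>] f]])
  qed
  then show ?thesis by blast
qed

section \<open>Dependent products and identity types\<close>

lemma pi_fibI:
  assumes "\<And>k f a. f \<in> hom k n \<Longrightarrow> a \<in> fib A k (restr \<Gamma> n f \<gamma>) \<Longrightarrow> \<phi> f a \<in> fib B k (restr \<Gamma> n f \<gamma>, a)"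
    and "\<And>j k f g a. f \<in> hom k n \<Longrightarrow> g \<in> hom j k \<Longrightarrow> a \<in> fib A k (restr \<Gamma> n f \<gamma>) \<Longrightarrow>
      \<phi> (f \<bullet> g) (tr A k (restr \<Gamma> n f \<gamma>) g a) = tr B k (restr \<Gamma> n f \<gamma>, a) g (\<phi> f a)"
    and "\<And>f a. \<not> (f \<in> hom (src f) n \<and> a \<in> fib A (src f) (restr \<Gamma> n f \<gamma>)) \<Longrightarrow> \<phi> f a = undefined"
  shows "\<phi> \<in> fib (pi_ty \<Gamma> A B) n \<gamma>"
  unfolding pi_ty_def fam.simps mem_Collect_eq
  by (intro conjI allI ballI impI; (rule assms; assumption))

lemma
  assumes "\<phi> \<in> fib (pi_ty \<Gamma> A B) n \<gamma>"
  shows pi_fib_in: "f \<in> hom k n \<Longrightarrow> a \<in> fib A k (restr \<Gamma> n f \<gamma>) \<Longrightarrow> \<phi> f a \<in> fib B k (restr \<Gamma> n f \<gamma>, a)"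
    and pi_fib_restr: "f \<in> hom k n \<Longrightarrow> g \<in> hom j k \<Longrightarrow> a \<in> fib A k (restr \<Gamma> n f \<gamma>) \<Longrightarrow>
      \<phi> (f \<bullet> g) (tr A k (restr \<Gamma> n f \<gamma>) g a) = tr B k (restr \<Gamma> n f \<gamma>, a) g (\<phi> f a)"
    and pi_fib_undefined: "\<not> (f \<in> hom (src f) n \<and> a \<in> fib A (src f) (restr \<Gamma> n f \<gamma>)) \<Longrightarrow> \<phi> f a = undefined"
  using assms unfolding pi_ty_def fam.simps mem_Collect_eq by blast+

lemma tr_pi: "tr (pi_ty \<Gamma> A B) n \<gamma> g \<phi> = (\<lambda>f a.
    if f \<in> hom (src f) (src g) \<and> a \<in> fib A (src f) (restr \<Gamma> n (g \<bullet> f) \<gamma>) then \<phi> (g \<bullet> f) a else undefined)"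
  by (simp only: pi_ty_def fam.simps)

lemma is_term_lam:
  assumes \<Gamma>: "simplicial_set \<Gamma>" and A: "family \<Gamma> A" and b: "is_term (ext \<Gamma> A) B b"
  shows "is_term \<Gamma> (pi_ty \<Gamma> A B) (\<lambda>n \<gamma> f a.
    if f \<in> hom (src f) n \<and> a \<in> fib A (src f) (restr \<Gamma> n f \<gamma>) then b (src f) (restr \<Gamma> n f \<gamma>, a) else undefined)"
    (is "is_term _ _ ?l")
proof (rule is_termI)
  fix n \<gamma> assume \<gamma>: "\<gamma> \<in> splx \<Gamma> n"
  show "?l n \<gamma> \<in> fib (pi_ty \<Gamma> A B) n \<gamma>"
  proof (rule pi_fibI)
    fix k f a assume f: "f \<in> hom k n" and a: "a \<in> fib A k (restr \<Gamma> n f \<gamma>)"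
    have x: "(restr \<Gamma> n f \<gamma>, a) \<in> splx (ext \<Gamma> A) k" using restr_in[OF \<Gamma> \<gamma> f] a by simp
    show "?l n \<gamma> f a \<in> fib B k (restr \<Gamma> n f \<gamma>, a)"
      using is_term_in[OF b x] f a by (simp add: src_hom[OF f])
    fix j g assume g: "g \<in> hom j k"
    show "?l n \<gamma> (f \<bullet> g) (tr A k (restr \<Gamma> n f \<gamma>) g a) = tr B k (restr \<Gamma> n f \<gamma>, a) g (?l n \<gamma> f a)"
      using is_term_restr[OF b x g] f a g cmp_hom[OF f g]
        tr_in[OF A restr_in[OF \<Gamma> \<gamma> f] a g] restr_cmp[OF \<Gamma> \<gamma> f g]
      by (simp add: src_hom[OF f] src_hom[OF g] del: cmp_hom)
  qed auto
next
  fix m n f \<gamma> assume \<gamma>: "\<gamma> \<in> splx \<Gamma> n" and f: "f \<in> hom m n"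
  show "?l m (restr \<Gamma> n f \<gamma>) = tr (pi_ty \<Gamma> A B) n \<gamma> f (?l n \<gamma>)"
    unfolding tr_pi src_hom[OF f]
    by (intro ext) (use f in \<open>auto simp: restr_cmp[OF \<Gamma> \<gamma> f]\<close>)
qed

lemma is_term_unlam:
  assumes \<Gamma>: "simplicial_set \<Gamma>" and A: "family \<Gamma> A" and h: "is_term \<Gamma> (pi_ty \<Gamma> A B) h"
  shows "is_term (ext \<Gamma> A) B (\<lambda>n x. h n (fst x) (idm n) (snd x))"
proof (rule is_termI)
  fix n x assume "x \<in> splx (ext \<Gamma> A) n"
  then obtain \<gamma> a where x: "x = (\<gamma>, a)" and \<gamma>: "\<gamma> \<in> splx \<Gamma> n" and a: "a \<in> fib A n \<gamma>" by (cases x) auto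
  have a': "a \<in> fib A n (restr \<Gamma> n (idm n) \<gamma>)" using a restr_idm[OF \<Gamma> \<gamma>] by simp
  note h\<gamma> = is_term_in[OF h \<gamma>]
  show "h n (fst x) (idm n) (snd x) \<in> fib B n x"
    using pi_fib_in[OF h\<gamma> idm_hom a'] restr_idm[OF \<Gamma> \<gamma>] by (simp add: x)
  fix m f assume f: "f \<in> hom m n"
  show "h m (fst (restr (ext \<Gamma> A) n f x)) (idm m) (snd (restr (ext \<Gamma> A) n f x)) =
      tr B n x f (h n (fst x) (idm n) (snd x))"
    using pi_fib_restr[OF h\<gamma> idm_hom f a'] restr_idm[OF \<Gamma> \<gamma>] f tr_in[OF A \<gamma> a f]
    by (simp add: x is_term_restr[OF h \<gamma> f] tr_pi src_hom[OF f])
qed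

lemma family_pi:
  assumes \<Gamma>: "simplicial_set \<Gamma>" and A: "family \<Gamma> A"
  shows "family \<Gamma> (pi_ty \<Gamma> A B)"
proof (rule familyI)
  fix m n f \<gamma> \<phi> assume \<gamma>: "\<gamma> \<in> splx \<Gamma> n" and \<phi>: "\<phi> \<in> fib (pi_ty \<Gamma> A B) n \<gamma>" and f: "f \<in> hom m n"
  show "tr (pi_ty \<Gamma> A B) n \<gamma> f \<phi> \<in> fib (pi_ty \<Gamma> A B) m (restr \<Gamma> n f \<gamma>)"
  proof (rule pi_fibI)
    fix k f' a assume f': "f' \<in> hom k m" and a: "a \<in> fib A k (restr \<Gamma> m f' (restr \<Gamma> n f \<gamma>))"
    have a': "a \<in> fib A k (restr \<Gamma> n (f \<bullet> f') \<gamma>)" using a restr_cmp[OF \<Gamma> \<gamma> f f'] by simp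
    have ff': "f \<bullet> f' \<in> hom k n" using f f' by blast
    show "tr (pi_ty \<Gamma> A B) n \<gamma> f \<phi> f' a \<in> fib B k (restr \<Gamma> m f' (restr \<Gamma> n f \<gamma>), a)"
      using pi_fib_in[OF \<phi> ff' a'] a' f f' by (simp add: tr_pi src_hom[OF f] src_hom[OF f'] restr_cmp[OF \<Gamma> \<gamma> f f'])
    fix j g assume g: "g \<in> hom j k"
    show "tr (pi_ty \<Gamma> A B) n \<gamma> f \<phi> (f' \<bullet> g) (tr A k (restr \<Gamma> m f' (restr \<Gamma> n f \<gamma>)) g a) =
        tr B k (restr \<Gamma> m f' (restr \<Gamma> n f \<gamma>), a) g (tr (pi_ty \<Gamma> A B) n \<gamma> f \<phi> f' a)"
      using pi_fib_restr[OF \<phi> ff' g a'] a' f f' g tr_in[OF A restr_in[OF \<Gamma> \<gamma> ff'] a' g]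
        restr_cmp[OF \<Gamma> \<gamma> ff' g]
      by (simp add: tr_pi restr_cmp[OF \<Gamma> \<gamma> f f'] cmp_assoc[OF f' g] src_hom[OF f] src_hom[OF f'] src_hom[OF g])
  qed (auto simp: tr_pi restr_cmp[OF \<Gamma> \<gamma> f] src_hom[OF f])
  fix k g assume g: "g \<in> hom k m"
  show "tr (pi_ty \<Gamma> A B) m (restr \<Gamma> n f \<gamma>) g (tr (pi_ty \<Gamma> A B) n \<gamma> f \<phi>) = tr (pi_ty \<Gamma> A B) n \<gamma> (f \<bullet> g) \<phi>"
    unfolding tr_pi src_hom[OF f] src_hom[OF g] src_hom[OF cmp_hom[OF f g]]
  proof (intro ext)
    fix f' a
    show "(if f' \<in> hom (src f') k \<and> a \<in> fib A (src f') (restr \<Gamma> m (g \<bullet> f') (restr \<Gamma> n f \<gamma>))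
        then if g \<bullet> f' \<in> hom (src (g \<bullet> f')) m \<and> a \<in> fib A (src (g \<bullet> f')) (restr \<Gamma> n (f \<bullet> (g \<bullet> f')) \<gamma>)
          then \<phi> (f \<bullet> (g \<bullet> f')) a else undefined
        else undefined) =
      (if f' \<in> hom (src f') k \<and> a \<in> fib A (src f') (restr \<Gamma> n (f \<bullet> g \<bullet> f') \<gamma>)
        then \<phi> (f \<bullet> g \<bullet> f') a else undefined)"
    proof (cases "f' \<in> hom (src f') k")
      case True
      show ?thesis
        using restr_cmp[OF \<Gamma> \<gamma> f cmp_hom[OF g True]] True cmp_hom[OF g True]
        by (simp add: cmp_assoc[OF g True])
    qed simp
  qed
next
  fix n \<gamma> \<phi> assume \<gamma>: "\<gamma> \<in> splx \<Gamma> n" and \<phi>: "\<phi> \<in> fib (pi_ty \<Gamma> A B) n \<gamma>"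
  show "tr (pi_ty \<Gamma> A B) n \<gamma> (idm n) \<phi> = \<phi>"
    unfolding tr_pi src_idm by (intro ext) (use pi_fib_undefined[OF \<phi>] in auto)
qed

section \<open>Identity types\<close>

lemma id_fibI:
  assumes "\<And>k f h. f \<in> hom k n \<Longrightarrow> h \<in> hom k 1 \<Longrightarrow> \<rho> f h \<in> fib A k (restr \<Gamma> n f \<gamma>)"
    and "\<And>j k f h g. f \<in> hom k n \<Longrightarrow> h \<in> hom k 1 \<Longrightarrow> g \<in> hom j k \<Longrightarrow>
      \<rho> (f \<bullet> g) (h \<bullet> g) = tr A k (restr \<Gamma> n f \<gamma>) g (\<rho> f h)"
    and "\<And>k f. f \<in> hom k n \<Longrightarrow> \<rho> f (replicate (Suc k) 0) = tr A n \<gamma> f (a n \<gamma>)"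
    and "\<And>k f. f \<in> hom k n \<Longrightarrow> \<rho> f (replicate (Suc k) 1) = tr A n \<gamma> f (b n \<gamma>)"
    and "\<And>f h. \<not> (f \<in> hom (src f) n \<and> h \<in> hom (src f) 1) \<Longrightarrow> \<rho> f h = undefined"
  shows "\<rho> \<in> fib (id_ty \<Gamma> A a b) n \<gamma>"
  unfolding id_ty_def fam.simps mem_Collect_eq
  by (intro conjI allI ballI impI; (rule assms; assumption))

lemma
  assumes "\<rho> \<in> fib (id_ty \<Gamma> A a b) n \<gamma>"
  shows id_fib_in: "f \<in> hom k n \<Longrightarrow> h \<in> hom k 1 \<Longrightarrow> \<rho> f h \<in> fib A k (restr \<Gamma> n f \<gamma>)"
    and id_fib_restr: "f \<in> hom k n \<Longrightarrow> h \<in> hom k 1 \<Longrightarrow> g \<in> hom j k \<Longrightarrow>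
      \<rho> (f \<bullet> g) (h \<bullet> g) = tr A k (restr \<Gamma> n f \<gamma>) g (\<rho> f h)"
    and id_fib_0: "f \<in> hom k n \<Longrightarrow> \<rho> f (replicate (Suc k) 0) = tr A n \<gamma> f (a n \<gamma>)"
    and id_fib_1: "f \<in> hom k n \<Longrightarrow> \<rho> f (replicate (Suc k) 1) = tr A n \<gamma> f (b n \<gamma>)"
    and id_fib_undefined: "\<not> (f \<in> hom (src f) n \<and> h \<in> hom (src f) 1) \<Longrightarrow> \<rho> f h = undefined"
  using assms unfolding id_ty_def fam.simps mem_Collect_eq by blast+

lemma tr_id: "tr (id_ty \<Gamma> A a b) n \<gamma> g \<rho> = (\<lambda>f h.
    if f \<in> hom (src f) (src g) \<and> h \<in> hom (src f) 1 then \<rho> (g \<bullet> f) h else undefined)"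
  by (simp only: id_ty_def fam.simps)

lemma family_id:
  assumes \<Gamma>: "simplicial_set \<Gamma>" and A: "family \<Gamma> A" and a: "is_term \<Gamma> A a" and b: "is_term \<Gamma> A b"
  shows "family \<Gamma> (id_ty \<Gamma> A a b)"
proof (rule familyI)
  fix m n f \<gamma> \<rho> assume \<gamma>: "\<gamma> \<in> splx \<Gamma> n" and \<rho>: "\<rho> \<in> fib (id_ty \<Gamma> A a b) n \<gamma>" and f: "f \<in> hom m n"
  show "tr (id_ty \<Gamma> A a b) n \<gamma> f \<rho> \<in> fib (id_ty \<Gamma> A a b) m (restr \<Gamma> n f \<gamma>)"
  proof (rule id_fibI)
    fix k f' assume f': "f' \<in> hom k m"
    have ff': "f \<bullet> f' \<in> hom k n" using f f' by blast
    show "tr (id_ty \<Gamma> A a b) n \<gamma> f \<rho> f' (replicate (Suc k) 0) = tr A m (restr \<Gamma> n f \<gamma>) f' (a m (restr \<Gamma> n f \<gamma>))"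
      using id_fib_0[OF \<rho> ff'] f f' replicate_hom[of 0 1 k]
      by (simp add: tr_id src_hom[OF f] src_hom[OF f'] is_term_restr[OF a \<gamma> f] tr_cmp[OF A \<gamma> is_term_in[OF a \<gamma>] f f'] del: replicate_Suc)
    show "tr (id_ty \<Gamma> A a b) n \<gamma> f \<rho> f' (replicate (Suc k) 1) = tr A m (restr \<Gamma> n f \<gamma>) f' (b m (restr \<Gamma> n f \<gamma>))"
      using id_fib_1[OF \<rho> ff'] f f' replicate_hom[of 1 1 k]
      by (simp add: tr_id src_hom[OF f] src_hom[OF f'] is_term_restr[OF b \<gamma> f] tr_cmp[OF A \<gamma> is_term_in[OF b \<gamma>] f f'] del: replicate_Suc)
    fix h assume h: "h \<in> hom k 1"
    show "tr (id_ty \<Gamma> A a b) n \<gamma> f \<rho> f' h \<in> fib A k (restr \<Gamma> m f' (restr \<Gamma> n f \<gamma>))"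
      using id_fib_in[OF \<rho> ff' h] f f' h by (simp add: tr_id src_hom[OF f] src_hom[OF f'] restr_cmp[OF \<Gamma> \<gamma> f f'])
    fix j g assume g: "g \<in> hom j k"
    show "tr (id_ty \<Gamma> A a b) n \<gamma> f \<rho> (f' \<bullet> g) (h \<bullet> g) =
        tr A k (restr \<Gamma> m f' (restr \<Gamma> n f \<gamma>)) g (tr (id_ty \<Gamma> A a b) n \<gamma> f \<rho> f' h)"
      using id_fib_restr[OF \<rho> ff' h g] f f' h g cmp_hom[OF h g] cmp_hom[OF f' g]
      by (simp add: tr_id src_hom[OF f] src_hom[OF f'] src_hom[OF g] restr_cmp[OF \<Gamma> \<gamma> f f'] cmp_assoc[OF f' g] del: cmp_hom)
  qed (auto simp: tr_id src_hom[OF f])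
  fix k g assume g: "g \<in> hom k m"
  show "tr (id_ty \<Gamma> A a b) m (restr \<Gamma> n f \<gamma>) g (tr (id_ty \<Gamma> A a b) n \<gamma> f \<rho>) = tr (id_ty \<Gamma> A a b) n \<gamma> (f \<bullet> g) \<rho>"
    unfolding tr_id src_hom[OF f] src_hom[OF g] src_hom[OF cmp_hom[OF f g]]
    by (intro ext) (use g in \<open>auto simp: cmp_assoc\<close>)
next
  fix n \<gamma> \<rho> assume \<gamma>: "\<gamma> \<in> splx \<Gamma> n" and \<rho>: "\<rho> \<in> fib (id_ty \<Gamma> A a b) n \<gamma>"
  show "tr (id_ty \<Gamma> A a b) n \<gamma> (idm n) \<rho> = \<rho>"
    unfolding tr_id src_idm by (intro ext) (use id_fib_undefined[OF \<rho>] in auto)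
qed

definition const_path :: "('g, 'a) fam \<Rightarrow> nat \<Rightarrow> 'g \<Rightarrow> 'a \<Rightarrow> nat list \<Rightarrow> nat list \<Rightarrow> 'a" where
  "const_path A n \<gamma> x = (\<lambda>f h. if f \<in> hom (src f) n \<and> h \<in> hom (src f) 1 then tr A n \<gamma> f x else undefined)"

text \<open>The endpoints are compared at \<open>\<gamma>\<close> only: the homotopy fibre of the
  vertex inclusion needs a constant path over a single vertex, where the two endpoints happen to
  agree.\<close>

lemma const_path_in:
  assumes A: "family \<Gamma> A" and \<gamma>: "\<gamma> \<in> splx \<Gamma> n" and x: "x \<in> fib A n \<gamma>" and ab: "a n \<gamma> = x" "b n \<gamma> = x"
  shows "const_path A n \<gamma> x \<in> fib (id_ty \<Gamma> A a b) n \<gamma>"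
proof (rule id_fibI)
  fix k f assume f: "f \<in> hom k n"
  show "const_path A n \<gamma> x f (replicate (Suc k) 0) = tr A n \<gamma> f (a n \<gamma>)"
    using f replicate_hom[of 0 1 k] by (simp add: const_path_def src_hom[OF f] ab del: replicate_Suc)
  show "const_path A n \<gamma> x f (replicate (Suc k) 1) = tr A n \<gamma> f (b n \<gamma>)"
    using f replicate_hom[of 1 1 k] by (simp add: const_path_def src_hom[OF f] ab del: replicate_Suc)
  fix h assume h: "h \<in> hom k 1"
  show "const_path A n \<gamma> x f h \<in> fib A k (restr \<Gamma> n f \<gamma>)"
    using tr_in[OF A \<gamma> x f] f h by (simp add: const_path_def src_hom[OF f])
  fix j g assume g: "g \<in> hom j k"
  show "const_path A n \<gamma> x (f \<bullet> g) (h \<bullet> g) = tr A k (restr \<Gamma> n f \<gamma>) g (const_path A n \<gamma> x f h)"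
    using tr_cmp[OF A \<gamma> x f g] f h g cmp_hom[OF h g] cmp_hom[OF f g]
    by (simp add: const_path_def src_hom[OF f] src_hom[OF g] del: cmp_hom)
qed (auto simp: const_path_def)

lemma is_term_const_path:
  assumes A: "family \<Gamma> A" and a: "is_term \<Gamma> A a"
    and ab: "\<And>n \<gamma>. \<gamma> \<in> splx \<Gamma> n \<Longrightarrow> b n \<gamma> = a n \<gamma>"
  shows "is_term \<Gamma> (id_ty \<Gamma> A a b) (\<lambda>n \<gamma>. const_path A n \<gamma> (a n \<gamma>))"
proof (rule is_termI)
  fix n \<gamma> assume \<gamma>: "\<gamma> \<in> splx \<Gamma> n"
  note a\<gamma> = is_term_in[OF a \<gamma>]
  show "const_path A n \<gamma> (a n \<gamma>) \<in> fib (id_ty \<Gamma> A a b) n \<gamma>"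
    by (rule const_path_in[OF A \<gamma> a\<gamma>]) (simp_all add: ab[OF \<gamma>])
  fix m f assume f: "f \<in> hom m n"
  show "const_path A m (restr \<Gamma> n f \<gamma>) (a m (restr \<Gamma> n f \<gamma>)) =
      tr (id_ty \<Gamma> A a b) n \<gamma> f (const_path A n \<gamma> (a n \<gamma>))"
    unfolding tr_id src_hom[OF f] const_path_def is_term_restr[OF a \<gamma> f]
    by (intro ext) (use f tr_cmp[OF A \<gamma> a\<gamma> f] in auto)
qed

section \<open>Propositions, sets and contractible types\<close>

lemma is_term_snd: "is_term (ext \<Gamma> A) (wk A) (\<lambda>n. snd)"
  by (rule is_termI) auto

lemma is_term_wk: "is_term \<Gamma> A a \<Longrightarrow> is_term (ext \<Gamma> C) (wk A) (\<lambda>n x. a n (fst x))"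
  by (rule is_termI) (auto simp: is_term_in is_term_restr)

lemma simplicial_set_ext2:
  assumes "simplicial_set \<Gamma>" "family \<Gamma> A"
  shows "simplicial_set (ext (ext \<Gamma> A) (wk A))"
  by (rule simplicial_set_ext[OF simplicial_set_ext[OF assms] family_wk[OF assms(2)]])

text \<open>The two variables of type \<open>A\<close> coincide on every simplex of the context, so
  constant paths form a term of their identity type.\<close>

lemma isprop_of_subsingleton:
  assumes \<Gamma>: "simplicial_set \<Gamma>" and A: "family \<Gamma> A"
    and sub: "\<And>n \<gamma> a b. \<gamma> \<in> splx \<Gamma> n \<Longrightarrow> a \<in> fib A n \<gamma> \<Longrightarrow> b \<in> fib A n \<gamma> \<Longrightarrow> a = b"
  shows "\<exists>h. is_term \<Gamma> (isprop_ty \<Gamma> A) h"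
  unfolding isprop_ty_def
  by (rule exI, rule is_term_lam[OF \<Gamma> A],
      rule is_term_lam[OF simplicial_set_ext[OF \<Gamma> A] family_wk[OF A]],
      rule is_term_const_path[OF family_wk[OF family_wk[OF A]] is_term_wk[OF is_term_snd]])
    (use sub in auto)

text \<open>When restriction fixes elements, a path takes equal values on a simplex and on its
  vertices, and so is determined by its endpoints. Any two paths with the same endpoints are then
  equal, and the identity types are subsingletons.\<close>

lemma isset_of_discrete:
  assumes \<Gamma>: "simplicial_set \<Gamma>" and A: "family \<Gamma> A"
    and disc: "\<And>m n \<gamma> a f. \<gamma> \<in> splx \<Gamma> n \<Longrightarrow> a \<in> fib A n \<gamma> \<Longrightarrow> f \<in> hom m n \<Longrightarrow> tr A n \<gamma> f a = a"
  shows "\<exists>h. is_term \<Gamma> (isset_ty \<Gamma> A) h"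
proof -
  let ?\<Gamma> = "ext (ext \<Gamma> A) (wk A)"
  let ?I = "id_ty ?\<Gamma> (wk (wk A)) (\<lambda>n \<gamma>. snd (fst \<gamma>)) (\<lambda>n \<gamma>. snd \<gamma>)"
  have fam: "family ?\<Gamma> ?I"
    by (rule family_id[OF simplicial_set_ext2[OF \<Gamma> A] family_wk[OF family_wk[OF A]]
          is_term_wk[OF is_term_snd] is_term_snd])
  have const: "\<rho> f h = snd x" if x: "x \<in> splx ?\<Gamma> n" and \<rho>: "\<rho> \<in> fib ?I n x"
    and f: "f \<in> hom k n" and h: "h \<in> hom k 1" for n x \<rho> f h k
  proof -
    obtain \<gamma> a b where x': "x = ((\<gamma>, a), b)" by (cases x) auto
    with x have \<gamma>: "\<gamma> \<in> splx \<Gamma> n" and a: "a \<in> fib A n \<gamma>" and b: "b \<in> fib A n \<gamma>" by auto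
    have restr: "\<rho> (f \<bullet> g) (h \<bullet> g) = \<rho> f h" if "f \<in> hom k n" "h \<in> hom k 1" "g \<in> hom j k" for f h g j k
      using id_fib_restr[OF \<rho> that] id_fib_in[OF \<rho> that(1,2)] that restr_in[OF \<Gamma> \<gamma> that(1)]
      by (simp add: x' disc)
    have ends: "\<rho> f (replicate (Suc k) 0) = a" "\<rho> f (replicate (Suc k) 1) = b" if "f \<in> hom k n" for f k
      using id_fib_0[OF \<rho> that] id_fib_1[OF \<rho> that] disc[OF \<gamma> _ that] a b
      by (simp_all add: x' del: replicate_Suc)
    have v: "replicate (Suc 0) i \<in> hom 0 k" if "i \<le> k" for i k by (rule replicate_hom[OF that])
    \<comment> \<open>The edge of \<Delta>[1], taken over a degenerate edge of \<Delta>[n], joins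
      the two ends of the path, so the existence of a path already makes \<open>a\<close> and
      \<open>b\<close> equal.\<close>
    have edge: "[0, 0] \<in> hom 1 n" "[0, 1] \<in> hom 1 1" by (auto simp: hom_def)
    have "\<rho> [0, 0] [0, 1] = a"
      using restr[OF edge v[of 0]] ends(1)[OF v[of 0 n]] by (simp add: cmp_def)
    moreover have "\<rho> [0, 0] [0, 1] = b"
      using restr[OF edge v[of 1]] ends(2)[OF v[of 0 n]] by (simp add: cmp_def)
    ultimately have ab: "a = b" by simp
    have fv: "[f ! 0] \<in> hom 0 n" using nth_hom_le[OF f, of 0] v[of "f ! 0" n] by simp
    \<comment> \<open>\<open>f\<close> and \<open>h\<close> are replaced by their first vertices,
      where \<open>\<rho>\<close> sits at one of its two ends.\<close>
    have "\<rho> f h = \<rho> [f ! 0] [h ! 0]"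
      using restr[OF f h v[of 0]] by (simp add: cmp_def)
    also have "\<dots> = b"
    proof (cases "h ! 0 = 0")
      case True
      then show ?thesis using ends(1)[OF fv] ab by simp
    next
      case False
      then have "h ! 0 = 1" using nth_hom_le[OF h, of 0] by simp
      then show ?thesis using ends(2)[OF fv] by simp
    qed
    finally show ?thesis by (simp add: x')
  qed
  have "\<exists>h. is_term ?\<Gamma> (isprop_ty ?\<Gamma> ?I) h"
  proof (rule isprop_of_subsingleton[OF simplicial_set_ext2[OF \<Gamma> A] fam])
    fix n x \<rho> \<rho>' assume x: "x \<in> splx ?\<Gamma> n" and \<rho>: "\<rho> \<in> fib ?I n x" and \<rho>': "\<rho>' \<in> fib ?I n x"
    show "\<rho> = \<rho>'"
    proof (intro ext)
      fix f h show "\<rho> f h = \<rho>' f h"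
      proof (cases "f \<in> hom (src f) n \<and> h \<in> hom (src f) 1")
        case True
        then show ?thesis using const[OF x \<rho>, of f "src f" h] const[OF x \<rho>', of f "src f" h] by simp
      next
        case False
        then show ?thesis using id_fib_undefined[OF \<rho>] id_fib_undefined[OF \<rho>'] by metis
      qed
    qed
  qed
  then obtain h where "is_term ?\<Gamma> (isprop_ty ?\<Gamma> ?I) h" ..
  from is_term_lam[OF \<Gamma> A is_term_lam[OF simplicial_set_ext[OF \<Gamma> A] family_wk[OF A] this]]
  show ?thesis unfolding isset_ty_def by blast
qed

text \<open>Applied to the generic pair of points, \<open>h\<close> gives a path over each simplex,
  and its value at \<open>idm n\<close> and \<open>t\<close> is the homotopy. Naturality combines
  restriction of the term along the context with restriction inside the path.\<close>

lemma fibrewise_homotopy_of_isprop: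
  assumes \<Gamma>: "simplicial_set \<Gamma>" and P: "family \<Gamma> P" and h: "is_term \<Gamma> (isprop_ty \<Gamma> P) h"
  shows "\<exists>H. fibrewise_homotopy \<Gamma> P H"
proof -
  let ?\<Gamma> = "ext (ext \<Gamma> P) (wk P)"
  let ?I = "id_ty ?\<Gamma> (wk (wk P)) (\<lambda>n \<gamma>. snd (fst \<gamma>)) (\<lambda>n \<gamma>. snd \<gamma>)"
  obtain k where k: "is_term ?\<Gamma> ?I k"
    using is_term_unlam[OF simplicial_set_ext[OF \<Gamma> P] family_wk[OF P]
        is_term_unlam[OF \<Gamma> P h[unfolded isprop_ty_def]]] by blast
  have "fibrewise_homotopy \<Gamma> P (\<lambda>n \<gamma> a b t. k n ((\<gamma>, a), b) (idm n) t)"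
    unfolding fibrewise_homotopy_def
  proof (intro allI ballI conjI)
    fix n \<gamma> a b assume \<gamma>: "\<gamma> \<in> splx \<Gamma> n" and a: "a \<in> fib P n \<gamma>" and b: "b \<in> fib P n \<gamma>"
    let ?x = "((\<gamma>, a), b)"
    have x: "?x \<in> splx ?\<Gamma> n" using \<gamma> a b by simp
    note kx = is_term_in[OF k x]
    show "k n ?x (idm n) (replicate (Suc n) 0) = a" "k n ?x (idm n) (replicate (Suc n) 1) = b"
      using id_fib_0[OF kx idm_hom] id_fib_1[OF kx idm_hom] tr_idm[OF P \<gamma>] a b
      by (simp_all del: replicate_Suc)
    fix t assume t: "t \<in> hom n 1"
    show "k n ?x (idm n) t \<in> fib P n \<gamma>"
      using id_fib_in[OF kx idm_hom t] restr_idm[OF \<Gamma> \<gamma>] by simp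
    fix m f assume f: "f \<in> hom m n"
    show "k m ((restr \<Gamma> n f \<gamma>, tr P n \<gamma> f a), tr P n \<gamma> f b) (idm m) (t \<bullet> f) =
        tr P n \<gamma> f (k n ?x (idm n) t)"
      using id_fib_restr[OF kx idm_hom t f] is_term_restr[OF k x f] restr_idm[OF \<Gamma> \<gamma>]
        f cmp_hom[OF t f] by (simp add: tr_id src_hom[OF f] del: cmp_hom)
  qed
  then show ?thesis by blast
qed

lemma ex_section_of_isprop:
  assumes \<Gamma>: "simplicial_set \<Gamma>" and P: "is_type \<Gamma> P" and "is_term \<Gamma> (isprop_ty \<Gamma> P) h"
    and "\<And>\<gamma>. \<gamma> \<in> splx \<Gamma> 0 \<Longrightarrow> fib P 0 \<gamma> \<noteq> {}"
  shows "\<exists>s. is_term \<Gamma> P s"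
  using fibrewise_homotopy_of_isprop[OF \<Gamma> is_type_family[OF P] assms(3)]
    ex_section_of_homotopy[OF \<Gamma> P _ assms(4)] by blast

lemma ex_iscontr:
  assumes \<Gamma>: "simplicial_set \<Gamma>" and T: "family \<Gamma> T" and h: "is_term \<Gamma> (isprop_ty \<Gamma> T) h"
    and t: "is_term \<Gamma> T t"
  shows "\<exists>c. is_term \<Gamma> (iscontr_ty \<Gamma> T) c"
proof -
  note u = is_term_unlam[OF \<Gamma> T h[unfolded isprop_ty_def]]
  have "is_term \<Gamma> (iscontr_ty \<Gamma> T) (\<lambda>n \<gamma>. (t n \<gamma>, h n \<gamma> (idm n) (t n \<gamma>)))"
  proof (rule is_termI)
    fix n \<gamma> assume \<gamma>: "\<gamma> \<in> splx \<Gamma> n"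
    have x: "(\<gamma>, t n \<gamma>) \<in> splx (ext \<Gamma> T) n" using \<gamma> is_term_in[OF t \<gamma>] by simp
    show "(t n \<gamma>, h n \<gamma> (idm n) (t n \<gamma>)) \<in> fib (iscontr_ty \<Gamma> T) n \<gamma>"
      using is_term_in[OF u x] is_term_in[OF t \<gamma>] by (simp add: iscontr_ty_def sigma_ty_def)
    fix m f assume f: "f \<in> hom m n"
    show "(t m (restr \<Gamma> n f \<gamma>), h m (restr \<Gamma> n f \<gamma>) (idm m) (t m (restr \<Gamma> n f \<gamma>))) =
        tr (iscontr_ty \<Gamma> T) n \<gamma> f (t n \<gamma>, h n \<gamma> (idm n) (t n \<gamma>))"
      using is_term_restr[OF u x f] is_term_restr[OF t \<gamma> f] by (simp add: iscontr_ty_def sigma_ty_def)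
  qed
  then show ?thesis by blast
qed

section \<open>Restriction to a subobject of the context\<close>

text \<open>The context enters only through \<open>restr\<close>, so passing to a simplicial subset
  leaves such types literally unchanged. A term found over the subset then takes its values in the
  fibres of the original type.\<close>

lemma pi_ty_cong: "restr \<Gamma> = restr \<Gamma>' \<Longrightarrow> B = B' \<Longrightarrow> pi_ty \<Gamma> A B = pi_ty \<Gamma>' A B'"
  by (simp only: pi_ty_def)

lemma id_ty_cong: "restr \<Gamma> = restr \<Gamma>' \<Longrightarrow> id_ty \<Gamma> A a b = id_ty \<Gamma>' A a b"
  by (simp only: id_ty_def)

lemma restr_ext_cong: "restr \<Gamma> = restr \<Gamma>' \<Longrightarrow> restr (ext \<Gamma> A) = restr (ext \<Gamma>' A)"
  by (simp only: ext_def sset.simps)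

lemma splx_ext_mono: "splx \<Delta> n \<subseteq> splx \<Gamma> n \<Longrightarrow> splx (ext \<Delta> A) n \<subseteq> splx (ext \<Gamma> A) n"
  by (auto simp: ext_def)

lemma isprop_ty_cong: "restr \<Gamma> = restr \<Gamma>' \<Longrightarrow> isprop_ty \<Gamma> A = isprop_ty \<Gamma>' A"
  unfolding isprop_ty_def by (intro pi_ty_cong id_ty_cong restr_ext_cong)

lemma isset_ty_cong:
  assumes "restr \<Gamma> = restr \<Gamma>'"
  shows "isset_ty \<Gamma> A = isset_ty \<Gamma>' A"
proof -
  have 2: "restr (ext (ext \<Gamma> A) (wk A)) = restr (ext (ext \<Gamma>' A) (wk A))"
    by (intro restr_ext_cong assms)
  show ?thesis
    unfolding isset_ty_def id_ty_cong[OF 2] isprop_ty_cong[OF 2]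
    by (intro pi_ty_cong restr_ext_cong assms refl)
qed

lemma iscontr_ty_cong: "restr \<Gamma> = restr \<Gamma>' \<Longrightarrow> iscontr_ty \<Gamma> A = iscontr_ty \<Gamma>' A"
  unfolding iscontr_ty_def
  by (intro arg_cong[where f = "sigma_ty A"] pi_ty_cong id_ty_cong restr_ext_cong)

lemma family_mono:
  assumes "family \<Gamma> A" "\<And>n. splx \<Delta> n \<subseteq> splx \<Gamma> n" "restr \<Delta> = restr \<Gamma>"
  shows "family \<Delta> A"
proof (rule familyI)
  fix m n f \<gamma> a assume *: "\<gamma> \<in> splx \<Delta> n" "a \<in> fib A n \<gamma>" "f \<in> hom m n"
  then have \<gamma>: "\<gamma> \<in> splx \<Gamma> n" using assms(2) by blast
  show "tr A n \<gamma> f a \<in> fib A m (restr \<Delta> n f \<gamma>)"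
    using tr_in[OF assms(1) \<gamma>] * assms(3) by simp
  show "tr A m (restr \<Delta> n f \<gamma>) g (tr A n \<gamma> f a) = tr A n \<gamma> (f \<bullet> g) a" if "g \<in> hom k m" for k g
    using tr_cmp[OF assms(1) \<gamma>] * that assms(3) by simp
next
  fix n \<gamma> a assume "\<gamma> \<in> splx \<Delta> n" "a \<in> fib A n \<gamma>"
  then show "tr A n \<gamma> (idm n) a = a" using tr_idm[OF assms(1)] assms(2) by blast
qed

lemma is_type_mono:
  assumes "is_type \<Gamma> A" "simplicial_set \<Delta>" "\<And>n. splx \<Delta> n \<subseteq> splx \<Gamma> n" "restr \<Delta> = restr \<Gamma>"
  shows "is_type \<Delta> A"
proof (rule is_type_pullback[OF _ assms(1,2)])
  show "simplicial_map \<Delta> \<Gamma> (\<lambda>n x. x)"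
    by (rule simplicial_mapI) (use assms in auto)
qed auto

lemma is_term_mono:
  assumes "is_term \<Gamma> A a" "\<And>n. splx \<Delta> n \<subseteq> splx \<Gamma> n" "restr \<Delta> = restr \<Gamma>"
  shows "is_term \<Delta> A a"
proof (rule is_termI)
  fix n \<gamma> assume "\<gamma> \<in> splx \<Delta> n"
  then have \<gamma>: "\<gamma> \<in> splx \<Gamma> n" using assms(2) by blast
  show "a n \<gamma> \<in> fib A n \<gamma>" by (rule is_term_in[OF assms(1) \<gamma>])
  show "a m (restr \<Delta> n f \<gamma>) = tr A n \<gamma> f (a n \<gamma>)" if "f \<in> hom m n" for m f
    using is_term_restr[OF assms(1) \<gamma> that] assms(3) by simp
qed

text \<open>\<open>hom n 0\<close> is a singleton, so this is the image of the map from \<Delta>[0]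
  at \<open>\<gamma>\<close>. It is kept as a subset of \<open>\<Gamma>\<close>, and not replaced by
  \<Delta>[0], so that types over \<open>\<Gamma>\<close> can be used on it without
  substitution.\<close>

definition vertex_orbit :: "'g sset \<Rightarrow> 'g \<Rightarrow> 'g sset" where
  "vertex_orbit \<Gamma> \<gamma> = \<lparr>splx = (\<lambda>n. {restr \<Gamma> 0 f \<gamma> | f. f \<in> hom n 0}), restr = restr \<Gamma>\<rparr>"

lemma restr_vertex_orbit [simp]: "restr (vertex_orbit \<Gamma> \<gamma>) = restr \<Gamma>"
  by (simp add: vertex_orbit_def)

context
  fixes \<Gamma> :: "'g sset" and \<gamma>
  assumes \<Gamma>: "simplicial_set \<Gamma>" and \<gamma>: "\<gamma> \<in> splx \<Gamma> 0"
begin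

lemma vertex_orbit_subset: "splx (vertex_orbit \<Gamma> \<gamma>) n \<subseteq> splx \<Gamma> n"
  using restr_in[OF \<Gamma> \<gamma>] by (auto simp: vertex_orbit_def)

lemma simplicial_set_vertex_orbit: "simplicial_set (vertex_orbit \<Gamma> \<gamma>)"
proof (rule simplicial_setI)
  fix m n f x assume x: "x \<in> splx (vertex_orbit \<Gamma> \<gamma>) n" and f: "f \<in> hom m n"
  have x': "x \<in> splx \<Gamma> n" using x vertex_orbit_subset by blast
  obtain e where e: "e \<in> hom n 0" "x = restr \<Gamma> 0 e \<gamma>" using x by (auto simp: vertex_orbit_def)
  have "restr \<Gamma> n f x = restr \<Gamma> 0 (e \<bullet> f) \<gamma>" using restr_cmp[OF \<Gamma> \<gamma> e(1) f] e(2) by simp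
  then show "restr (vertex_orbit \<Gamma> \<gamma>) n f x \<in> splx (vertex_orbit \<Gamma> \<gamma>) m"
    using cmp_hom[OF e(1) f] by (auto simp: vertex_orbit_def)
  show "restr (vertex_orbit \<Gamma> \<gamma>) m g (restr (vertex_orbit \<Gamma> \<gamma>) n f x) = restr (vertex_orbit \<Gamma> \<gamma>) n (f \<bullet> g) x"
    if "g \<in> hom k m" for k g
    using restr_cmp[OF \<Gamma> x' f that] by simp
next
  fix n x assume "x \<in> splx (vertex_orbit \<Gamma> \<gamma>) n"
  then show "restr (vertex_orbit \<Gamma> \<gamma>) n (idm n) x = x"
    using vertex_orbit_subset restr_idm[OF \<Gamma>] by fastforce
qed

lemma vertex_orbit_0: "splx (vertex_orbit \<Gamma> \<gamma>) 0 = {\<gamma>}"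
proof -
  have "f \<in> hom 0 0 \<longleftrightarrow> f = idm 0" for f
    by (simp add: hom_0_iff idm_def)
  then show ?thesis using restr_idm[OF \<Gamma> \<gamma>] by (auto simp: vertex_orbit_def)
qed

end

section \<open>The universe\<close>

lemma fib_precomp: "f \<in> hom m n \<Longrightarrow> x \<in> hom k m \<Longrightarrow> fib (precomp n f A) k x = fib A k (f \<bullet> x)"
  by (simp add: precomp_def src_hom)

lemma tr_precomp: "f \<in> hom m n \<Longrightarrow> x \<in> hom k m \<Longrightarrow> g \<in> hom j k \<Longrightarrow> a \<in> fib A k (f \<bullet> x)
   \<Longrightarrow> tr (precomp n f A) k x g a = tr A k (f \<bullet> x) g a"
  by (simp add: precomp_def src_hom[of f m n] src_hom[of g j k])

text \<open>The guards in \<open>precomp\<close> make the two sides agree off their domain as well;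
  the universe therefore satisfies the simplicial identities as equations between families.\<close>

lemma precomp_precomp:
  assumes f: "f \<in> hom m n" and g: "g \<in> hom k m"
  shows "precomp m g (precomp n f A) = precomp n (f \<bullet> g) A"
proof (rule fam.equality)
  show "fib (precomp m g (precomp n f A)) = fib (precomp n (f \<bullet> g) A)"
    unfolding precomp_def fam.simps src_cmp src_hom[OF f] src_hom[OF g]
    by (intro ext) (use g in \<open>simp add: cmp_assoc[OF g]\<close>)
  show "tr (precomp m g (precomp n f A)) = tr (precomp n (f \<bullet> g) A)"
    unfolding precomp_def fam.simps src_cmp src_hom[OF f] src_hom[OF g]
  proof (intro ext, goal_cases)
    case (1 l x h a)
    show ?case
    proof (cases "x \<in> hom l k")
      case True
      then show ?thesis using cmp_hom[OF g True] by (simp add: cmp_assoc[OF g True])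
    qed simp
  qed
qed simp

lemma univD:
  assumes "A \<in> splx (univ \<beta>) n"
  shows "is_type (Delta n) A" "x \<in> hom k n \<Longrightarrow> \<exists>b\<in>Field \<beta>. fib A k x = underS \<beta> b"
    "precomp n (idm n) A = A"
  using assms by (auto simp: univ_def)

lemma restr_univ [simp]: "restr (univ \<beta>) = precomp"
  by (simp add: univ_def)

lemma is_type_precomp:
  assumes f: "f \<in> hom m n" and A: "is_type (Delta n) A"
  shows "is_type (Delta m) (precomp n f A)"
proof (rule is_type_pullback[OF _ A simplicial_set_Delta])
  show "simplicial_map (Delta m) (Delta n) (\<lambda>k x. f \<bullet> x)"
    by (rule simplicial_mapI) (use f in \<open>auto simp: cmp_assoc\<close>)
qed (use f in \<open>auto simp: fib_precomp tr_precomp\<close>)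

lemma simplicial_set_univ: "simplicial_set (univ \<beta>)"
proof (rule simplicial_setI)
  fix m n f A assume A: "A \<in> splx (univ \<beta>) n" and f: "f \<in> hom m n"
  have "\<exists>b\<in>Field \<beta>. fib (precomp n f A) k x = underS \<beta> b" if "x \<in> hom k m" for k x
    unfolding fib_precomp[OF f that] by (rule univD(2)[OF A cmp_hom[OF f that]])
  with is_type_precomp[OF f univD(1)[OF A]] precomp_precomp[OF f idm_hom]
  show "restr (univ \<beta>) n f A \<in> splx (univ \<beta>) m"
    using f by (simp add: univ_def)
  show "restr (univ \<beta>) m g (restr (univ \<beta>) n f A) = restr (univ \<beta>) n (f \<bullet> g) A" if "g \<in> hom k m" for k g
    using precomp_precomp[OF f that] by simp
next
  fix n A assume "A \<in> splx (univ \<beta>) n"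
  then show "restr (univ \<beta>) n (idm n) A = A" using univD(3) by simp
qed

lemma fib_el [simp]: "fib (el_ty \<sigma>) n \<gamma> = fib (\<sigma> n \<gamma>) n (idm n)"
  and tr_el [simp]: "tr (el_ty \<sigma>) n \<gamma> = tr (\<sigma> n \<gamma>) n (idm n)"
  by (simp_all add: el_ty_def)

text \<open>Restricting an element over the top simplex of \<open>A\<close> along \<open>f\<close>
  gives an element over \<open>f\<close>, which corresponds to the top simplex of
  \<open>precomp n f A\<close>.\<close>

lemma family_el:
  assumes "simplicial_map \<Gamma> (univ \<beta>) \<sigma>"
  shows "family \<Gamma> (el_ty \<sigma>)"
  unfolding el_ty_def
proof (rule family_subst[OF assms], rule familyI, unfold fam.simps restr_univ)
  fix m n f A a assume A: "A \<in> splx (univ \<beta>) n" and a: "a \<in> fib A n (idm n)" and f: "f \<in> hom m n"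
  note fam = is_type_family[OF univD(1)[OF A]]
  have i: "idm n \<in> splx (Delta n) n" by simp
  have b: "tr A n (idm n) f a \<in> fib A m (f \<bullet> idm m)" using tr_in[OF fam i a f] f by simp
  then show "tr A n (idm n) f a \<in> fib (precomp n f A) m (idm m)"
    by (simp add: fib_precomp[OF f idm_hom])
  show "tr (precomp n f A) m (idm m) g (tr A n (idm n) f a) = tr A n (idm n) (f \<bullet> g) a"
    if g: "g \<in> hom k m" for k g
    using tr_cmp[OF fam i a f g] f by (simp add: tr_precomp[OF f idm_hom g b])
next
  fix n A a assume A: "A \<in> splx (univ \<beta>) n" and a: "a \<in> fib A n (idm n)"
  show "tr A n (idm n) (idm n) a = a"
    by (rule tr_idm[OF is_type_family[OF univD(1)[OF A]] _ a]) simp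
qed

text \<open>The constant simplicial set on \<open>D\<close>, with every operator acting as the
  identity. The guards give it the normal form required of a simplex of \<open>univ\<close>.\<close>

definition discrete :: "'b set \<Rightarrow> (nat list, 'b) fam" where
  "discrete D =
    \<lparr>fib = (\<lambda>k x. if x \<in> hom k 0 then D else {}),
     tr = (\<lambda>k x g a. if x \<in> hom k 0 \<and> g \<in> hom (src g) k \<and> a \<in> D then a else undefined)\<rparr>"

lemma fib_discrete [simp]: "x \<in> hom k 0 \<Longrightarrow> fib (discrete D) k x = D"
  by (simp add: discrete_def)

lemma tr_discrete: "x \<in> hom k 0 \<Longrightarrow> g \<in> hom j k \<Longrightarrow> a \<in> D \<Longrightarrow> tr (discrete D) k x g a = a"
  by (simp add: discrete_def src_hom[of g j k])

text \<open>A horn is connected and restriction fixes elements, so a map from a horn has a single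
  value in \<open>D\<close>, and that value fills it.\<close>

lemma is_type_discrete: "is_type (Delta 0) (discrete D)"
proof -
  have fam: "family (Delta 0) (discrete D)"
    by (rule familyI) (auto simp: tr_discrete tr_discrete[OF _ idm_hom] tr_discrete[OF _ cmp_hom])
  have "kan_fibration (ext (Delta 0) (discrete D)) (Delta 0) (\<lambda>n. fst)"
    unfolding kan_fibration_def
  proof (intro conjI simplicial_map_fst allI impI)
    fix n k :: nat and u v
    assume n: "1 \<le> n" "k \<le> n" and u: "simplicial_map (horn n k) (ext (Delta 0) (discrete D)) u"
      and v: "simplicial_map (Delta n) (Delta 0) v" and uv: "\<forall>m. \<forall>x\<in>splx (horn n k) m. fst (u m x) = v m x"
    have u_in: "fst (u m x) \<in> hom m 0" "snd (u m x) \<in> D" if "x \<in> splx (horn n k) m" for m x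
      using simplicial_map_in[OF u that] by (cases "u m x"; simp)+
    have u_restr: "snd (u j (x \<bullet> g)) = snd (u m x)" if "x \<in> splx (horn n k) m" "g \<in> hom j m" for j g m x
      using simplicial_map_restr[OF u that] u_in[OF that(1)] that(2)
      by (cases "u m x") (simp add: tr_discrete)
    have vert: "[i] \<in> hom 0 m" if "i \<le> m" for i m using that by (auto simp: hom_def)
    \<comment> \<open>\<open>[k]\<close> has to miss a vertex other than \<open>k\<close>; since
      \<open>n\<close> is positive, one of \<open>0\<close> and \<open>1\<close> serves.\<close>
    have k: "[k] \<in> splx (horn n k) 0"
      using n vert[of k n] by (auto simp: splx_horn intro: exI[of _ "if k = 0 then 1 else 0"])
    have snd_u: "snd (u m x) = snd (u 0 [k])" if x: "x \<in> splx (horn n k) m" for m x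
    proof -
      obtain i where i: "i \<le> n" "i \<noteq> k" "i \<notin> set x" and xh: "x \<in> hom m n"
        using x by (auto simp: splx_horn)
      define l where "l = x ! 0"
      have l: "l \<le> n" "i \<noteq> l"
        using nth_hom_le[OF xh, of 0] i(3) length_hom[OF xh] by (auto simp: l_def)
      have "snd (u m x) = snd (u 0 [l])"
        using u_restr[OF x vert[of 0]] by (simp add: cmp_def l_def)
      also have "\<dots> = snd (u 0 [k])"
      proof -
        \<comment> \<open>The edge between \<open>l\<close> and \<open>k\<close> stays in the horn
          because it misses the same \<open>i\<close> as \<open>x\<close>. \<open>min\<close> and
          \<open>max\<close> put its vertices in order, and \<open>l = k\<close> gives a degenerate
          edge.\<close>
        have e: "[min l k, max l k] \<in> splx (horn n k) 1"
          using l n i by (auto simp: splx_horn hom_def min_def max_def)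
        have "snd (u 0 [min l k]) = snd (u 0 [max l k])"
          using u_restr[OF e vert[of 0]] u_restr[OF e vert[of 1]] by (simp add: cmp_def)
        then show ?thesis by (simp add: min_def max_def split: if_splits)
      qed
      finally show ?thesis .
    qed
    show "\<exists>w. simplicial_map (Delta n) (ext (Delta 0) (discrete D)) w \<and>
        (\<forall>m. \<forall>x\<in>splx (horn n k) m. w m x = u m x) \<and>
        (\<forall>m. \<forall>x\<in>splx (Delta n) m. fst (w m x) = v m x)"
    proof (intro exI conjI allI ballI)
      show "simplicial_map (Delta n) (ext (Delta 0) (discrete D)) (\<lambda>m x. (v m x, snd (u 0 [k])))"
      proof (rule simplicial_mapI)
        fix m x assume x: "x \<in> splx (Delta n) m"
        then have vx: "v m x \<in> hom m 0" using simplicial_map_in[OF v x] by simp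
        then show "(v m x, snd (u 0 [k])) \<in> splx (ext (Delta 0) (discrete D)) m"
          using u_in(2)[OF k] by simp
        show "(v j (restr (Delta n) m f x), snd (u 0 [k])) =
            restr (ext (Delta 0) (discrete D)) m f (v m x, snd (u 0 [k]))" if f: "f \<in> hom j m" for j f
          using simplicial_map_restr[OF v x f] tr_discrete[OF vx f u_in(2)[OF k]] by simp
      qed
      show "(v m x, snd (u 0 [k])) = u m x" if "x \<in> splx (horn n k) m" for m x
        using snd_u[OF that] uv that by (simp add: prod_eq_iff)
    qed simp
  qed
  with fam show ?thesis by (simp add: is_type_def)
qed

lemma discrete_in_univ:
  assumes "b \<in> Field \<beta>"
  shows "discrete (underS \<beta> b) \<in> splx (univ \<beta>) 0"
proof -
  have "precomp 0 (idm 0) (discrete D) = discrete D" for D :: "'a set"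
    by (rule fam.equality) (auto simp: precomp_def discrete_def fun_eq_iff)
  then show ?thesis
    using assms is_type_discrete by (auto simp: univ_def)
qed

section \<open>Covering a type by its set of vertices\<close>

lemma simplicial_set_empty_ctx: "simplicial_set empty_ctx"
  by (simp add: simplicial_set_def empty_ctx_def)

lemma simplicial_set_ctx_X: "simplicial_set (ctx_X \<beta>)"
  unfolding ctx_X_def
  by (rule simplicial_set_ext[OF simplicial_set_empty_ctx family_const[OF simplicial_set_univ]])

lemma simplicial_set_ctx_XS: "simplicial_set (ctx_XS \<beta>)"
  unfolding ctx_XS_def
  by (rule simplicial_set_ext[OF simplicial_set_ctx_X family_const[OF simplicial_set_univ]])

lemma simplicial_map_S: "simplicial_map (ctx_XS \<beta>) (univ \<beta>) (\<lambda>n. snd)"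
  unfolding ctx_XS_def by (rule simplicial_map_snd_const)

lemma simplicial_map_X: "simplicial_map (ctx_XS \<beta>) (univ \<beta>) (\<lambda>n \<gamma>. snd (fst \<gamma>))"
  unfolding ctx_XS_def ctx_X_def
  by (rule simplicial_map_comp[OF simplicial_map_fst simplicial_map_snd_const])

lemma family_map_ty: "family (ctx_XS \<beta>) (map_ty \<beta>)"
  unfolding map_ty_def arrow_ty_def
  by (rule family_pi[OF simplicial_set_ctx_XS family_el[OF simplicial_map_S]])

lemma simplicial_set_ctx_XSg: "simplicial_set (ctx_XSg \<beta>)"
  unfolding ctx_XSg_def by (rule simplicial_set_ext[OF simplicial_set_ctx_XS family_map_ty])

lemma family_el_X: "family (ctx_XSg \<beta>) (el_ty (\<lambda>n \<gamma>. snd (fst (fst \<gamma>))))"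
  unfolding ctx_XSg_def
  by (rule family_el[OF simplicial_map_comp[OF simplicial_map_fst simplicial_map_X]])

lemma restr_ctx_XS: "restr (ctx_XS \<beta>) n f ((u, X), S) = ((u, precomp n f X), precomp n f S)"
  by (simp add: ctx_XS_def ctx_X_def empty_ctx_def const_ty_def)

lemma ctx_XS_iff: "((u, X), S) \<in> splx (ctx_XS \<beta>) n \<longleftrightarrow> X \<in> splx (univ \<beta>) n \<and> S \<in> splx (univ \<beta>) n"
  by (simp add: ctx_XS_def ctx_X_def empty_ctx_def const_ty_def)

text \<open>The map from X_0 to X that sends a vertex to its degeneracies, \<open>f\<close> being
  the unique map to [0]. The guard puts it into the form in which \<open>pi_ty\<close> encodes
  functions.\<close>

definition vertex_inclusion :: "(nat list, 'b) fam \<Rightarrow> nat list \<Rightarrow> 'b \<Rightarrow> 'b" where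
  "vertex_inclusion X = (\<lambda>f a. if f \<in> hom (src f) 0 \<and> a \<in> fib X 0 (idm 0) then tr X 0 (idm 0) f a else undefined)"

lemma vertex_inclusion_in:
  assumes X: "X \<in> splx (univ \<beta>) 0"
  shows "vertex_inclusion X \<in> fib (map_ty \<beta>) 0 (((), X), discrete (fib X 0 (idm 0)))"
  unfolding map_ty_def arrow_ty_def
proof (rule pi_fibI, unfold restr_ctx_XS fib_el tr_el fib_subst tr_subst fst_conv snd_conv)
  let ?D = "fib X 0 (idm 0)"
  note fam = is_type_family[OF univD(1)[OF X]]
  have i: "idm 0 \<in> splx (Delta 0) 0" by simp
  have fib_D: "fib (precomp 0 f (discrete ?D)) k (idm k) = ?D" if "f \<in> hom k 0" for f k
    using that by (simp add: fib_precomp[OF that idm_hom])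
  fix k f a assume f: "f \<in> hom k 0" and "a \<in> fib (precomp 0 f (discrete ?D)) k (idm k)"
  then have a: "a \<in> ?D" using fib_D by simp
  have b: "tr X 0 (idm 0) f a \<in> fib X k (f \<bullet> idm k)"
    using tr_in[OF fam i a f] f by simp
  then show "vertex_inclusion X f a \<in> fib (precomp 0 f X) k (idm k)"
    using f a by (simp add: vertex_inclusion_def fib_precomp[OF f idm_hom] src_hom[OF f])
  fix j g assume g: "g \<in> hom j k"
  have tr_D: "tr (precomp 0 f (discrete ?D)) k (idm k) g a = a"
    using tr_discrete[OF f g a] f a by (simp add: tr_precomp[OF f idm_hom g])
  show "vertex_inclusion X (f \<bullet> g) (tr (precomp 0 f (discrete ?D)) k (idm k) g a) =
      tr (precomp 0 f X) k (idm k) g (vertex_inclusion X f a)"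
    unfolding tr_D
    using tr_cmp[OF fam i a f g] f g a b cmp_hom[OF f g]
    by (simp add: vertex_inclusion_def src_hom[OF f] src_hom[OF g] tr_precomp[OF f idm_hom g b] del: cmp_hom)
next
  let ?D = "fib X 0 (idm 0)"
  fix f a assume "\<not> (f \<in> hom (src f) 0 \<and> a \<in> fib (precomp 0 f (discrete ?D)) (src f) (idm (src f)))"
  then show "vertex_inclusion X f a = undefined"
    using fib_precomp[of f "src f" 0 "idm (src f)" "src f" "discrete ?D"] cmp_idm[of f "src f" 0]
    by (auto simp: vertex_inclusion_def)
qed

text \<open>Over the orbit of the vertex, the variable S is the constant family on \<open>D\<close>
  in every dimension, so restriction acts as the identity. The value at the vertex of the term found
  there is the required element.\<close>

lemma ex_isset:
  assumes X: "X \<in> splx (univ \<beta>) 0" and D: "discrete D \<in> splx (univ \<beta>) 0"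
  shows "\<exists>i. i \<in> fib (isset_ty (ctx_XS \<beta>) (el_ty (\<lambda>n \<gamma>. snd \<gamma>))) 0 (((), X), discrete D)"
proof -
  let ?\<gamma> = "(((), X), discrete D)" and ?A = "el_ty (\<lambda>n \<gamma>. snd \<gamma>)"
  let ?\<Gamma> = "vertex_orbit (ctx_XS \<beta>) ?\<gamma>"
  have \<gamma>: "?\<gamma> \<in> splx (ctx_XS \<beta>) 0" using X D by (simp add: ctx_XS_iff)
  note ss = simplicial_set_ctx_XS
  have "\<exists>h. is_term ?\<Gamma> (isset_ty ?\<Gamma> ?A) h"
  proof (rule isset_of_discrete[OF simplicial_set_vertex_orbit[OF ss \<gamma>]])
    show "family ?\<Gamma> ?A"
      by (rule family_mono[OF family_el[OF simplicial_map_S] vertex_orbit_subset[OF ss \<gamma>]]) simp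
    fix m n x a f assume "x \<in> splx ?\<Gamma> n" and a: "a \<in> fib ?A n x" and f: "f \<in> hom m n"
    then obtain e where e: "e \<in> hom n 0" and x: "snd x = precomp 0 e (discrete D)"
      by (auto simp: vertex_orbit_def restr_ctx_XS)
    have "a \<in> D" using a e by (simp add: x fib_precomp[OF e idm_hom])
    then show "tr ?A n x f a = a"
      using e tr_discrete[OF e f] by (simp add: x tr_precomp[OF e idm_hom f])
  qed
  then obtain h where "is_term ?\<Gamma> (isset_ty ?\<Gamma> ?A) h" ..
  from is_term_in[OF this, of ?\<gamma> 0] show ?thesis
    using isset_ty_cong[of ?\<Gamma> "ctx_XS \<beta>" ?A] by (auto simp: vertex_orbit_0[OF ss \<gamma>])
qed

lemma ex_conn:
  assumes T: "prop_trunc (ctx_XSgx \<beta>) (fib_g_x \<beta>) T \<eta>"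
    and X: "X \<in> splx (univ \<beta>) 0" and S: "discrete (fib X 0 (idm 0)) \<in> splx (univ \<beta>) 0"
  shows "\<exists>c. c \<in> fib (conn_ty \<beta> T) 0 ((((), X), discrete (fib X 0 (idm 0))), vertex_inclusion X)"
proof -
  let ?D = "fib X 0 (idm 0)"
  let ?\<gamma> = "((((), X), discrete ?D), vertex_inclusion X)"
  let ?A = "el_ty (\<lambda>n \<gamma>. snd (fst (fst \<gamma>)))"
  let ?\<Gamma> = "vertex_orbit (ctx_XSg \<beta>) ?\<gamma>"
  \<comment> \<open>The orbit is a single point, giving values to X, S and g, so
    \<open>?\<Delta>\<close> is a copy of X. A section of \<open>T\<close> over it expresses that
    the map is surjective.\<close>
  let ?\<Delta> = "ext ?\<Gamma> ?A"
  note ss = simplicial_set_ctx_XSg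
  have \<gamma>: "?\<gamma> \<in> splx (ctx_XSg \<beta>) 0"
    using X S vertex_inclusion_in[OF X] by (simp add: ctx_XSg_def ctx_XS_iff)
  have ss': "simplicial_set ?\<Gamma>" by (rule simplicial_set_vertex_orbit[OF ss \<gamma>])
  have fam: "family ?\<Gamma> ?A"
    by (rule family_mono[OF family_el_X vertex_orbit_subset[OF ss \<gamma>]]) simp
  have ss\<Delta>: "simplicial_set ?\<Delta>" by (rule simplicial_set_ext[OF ss' fam])
  have sub: "splx ?\<Delta> n \<subseteq> splx (ctx_XSgx \<beta>) n" for n
    unfolding ctx_XSgx_def by (rule splx_ext_mono[OF vertex_orbit_subset[OF ss \<gamma>]])
  have restr: "restr ?\<Delta> = restr (ctx_XSgx \<beta>)"
    unfolding ctx_XSgx_def by (rule restr_ext_cong) simp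
  obtain h where Ty: "is_type (ctx_XSgx \<beta>) T" and \<eta>: "is_term (ext (ctx_XSgx \<beta>) (fib_g_x \<beta>)) (wk T) \<eta>"
    and h: "is_term (ctx_XSgx \<beta>) (isprop_ty (ctx_XSgx \<beta>) T) h"
    using T unfolding prop_trunc_def by blast
  have Ty': "is_type ?\<Delta> T" by (rule is_type_mono[OF Ty ss\<Delta> sub restr])
  have h': "is_term ?\<Delta> (isprop_ty ?\<Delta> T) h"
    unfolding isprop_ty_cong[OF restr] by (rule is_term_mono[OF h sub restr])
  \<comment> \<open>Elements over the vertices of X suffice, although the simplices of X in higher
    dimensions need not lift to X_0.\<close>
  have "\<exists>t. is_term ?\<Delta> T t"
  proof (rule ex_section_of_isprop[OF ss\<Delta> Ty' h'])
    fix y assume y: "y \<in> splx ?\<Delta> 0"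
    then obtain x where y': "y = (?\<gamma>, x)" and x: "x \<in> ?D"
      using vertex_orbit_0[OF ss \<gamma>] by (cases y) auto
    have y'': "y \<in> splx (ctx_XSgx \<beta>) 0" using y sub by blast
    have tr: "tr X 0 (idm 0) (idm 0) x = x"
      by (rule tr_idm[OF is_type_family[OF univD(1)[OF X]] _ x]) simp
    let ?S = "el_ty (\<lambda>n \<gamma>. snd (fst (fst \<gamma>)))"
    let ?X = "wk (el_ty (\<lambda>n \<gamma>. snd (fst (fst (fst \<gamma>)))))"
    have fam_X: "family (ext (ctx_XSgx \<beta>) ?S) ?X"
      unfolding ctx_XSgx_def ctx_XSg_def
      by (rule family_wk[OF family_el[OF simplicial_map_comp[OF simplicial_map_fst
            simplicial_map_comp[OF simplicial_map_fst simplicial_map_X]]]])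
    \<comment> \<open>The map sends \<open>x\<close> to \<open>tr X 0 (idm 0) (idm 0) x\<close>,
      which is \<open>x\<close> itself, so the constant path at \<open>x\<close> places
      \<open>x\<close> in the homotopy fibre over \<open>x\<close>.\<close>
    let ?p = "const_path ?X 0 (y, x) x"
    have "?p \<in> fib (id_ty (ext (ctx_XSgx \<beta>) ?S) ?X
        (app (\<lambda>n \<gamma>. snd (fst (fst \<gamma>))) (\<lambda>n \<gamma>. snd \<gamma>)) (\<lambda>n \<gamma>. snd (fst \<gamma>))) 0 (y, x)"
      by (rule const_path_in[OF fam_X]) (use x tr y'' in \<open>simp_all add: y' app_def vertex_inclusion_def\<close>)
    with x have "(x, ?p) \<in> fib (fib_g_x \<beta>) 0 y"
      by (simp add: fib_g_x_def fibre_ty_def sigma_ty_def y')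
    with y'' have "(y, (x, ?p)) \<in> splx (ext (ctx_XSgx \<beta>) (fib_g_x \<beta>)) 0" by simp
    from is_term_in[OF \<eta> this] show "fib T 0 y \<noteq> {}" by auto
  qed
  then obtain t where "is_term ?\<Delta> T t" ..
  then obtain c where c: "is_term ?\<Delta> (iscontr_ty ?\<Delta> T) c"
    using ex_iscontr[OF ss\<Delta> is_type_family[OF Ty'] h'] by blast
  have "conn_ty \<beta> T = pi_ty ?\<Gamma> ?A (iscontr_ty ?\<Delta> T)"
    unfolding conn_ty_def iscontr_ty_cong[OF restr] by (rule pi_ty_cong) simp_all
  with is_term_in[OF is_term_lam[OF ss' fam c], of ?\<gamma> 0] vertex_orbit_0[OF ss \<gamma>]
  show ?thesis by auto
qed

theorem corollary5p14:
  fixes \<beta> :: "'b rel"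
  assumes "inaccessible \<beta>"
    and "prop_trunc (ctx_XSgx \<beta>) (fib_g_x \<beta>) T \<eta>"
    and "prop_trunc (ctx_X \<beta>) (set_cover_ty \<beta> T) M \<mu>"
  shows "\<exists>s. is_term empty_ctx (pi_ty empty_ctx (const_ty (univ \<beta>)) M) s"
proof -
  obtain h where M: "is_type (ctx_X \<beta>) M" and \<mu>: "is_term (ext (ctx_X \<beta>) (set_cover_ty \<beta> T)) (wk M) \<mu>"
    and h: "is_term (ctx_X \<beta>) (isprop_ty (ctx_X \<beta>) M) h"
    using assms(3) unfolding prop_trunc_def by blast
  have "\<exists>s. is_term (ctx_X \<beta>) M s"
  proof (rule ex_section_of_isprop[OF simplicial_set_ctx_X M h])
    fix \<gamma> assume \<gamma>: "\<gamma> \<in> splx (ctx_X \<beta>) 0"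
    then obtain X where \<gamma>': "\<gamma> = ((), X)" and X: "X \<in> splx (univ \<beta>) 0"
      by (cases \<gamma>) (auto simp: ctx_X_def const_ty_def)
    let ?S = "discrete (fib X 0 (idm 0))"
    \<comment> \<open>X_0 is small enough for U: its elements form a fibre of X, which is already a
      proper initial segment of \<open>\<beta>\<close>, so no well-ordering has to be chosen for
      it.\<close>
    obtain b where "b \<in> Field \<beta>" "fib X 0 (idm 0) = underS \<beta> b"
      using univD(2)[OF X idm_hom] by blast
    then have S: "?S \<in> splx (univ \<beta>) 0" using discrete_in_univ by metis
    obtain i where i: "i \<in> fib (isset_ty (ctx_XS \<beta>) (el_ty (\<lambda>n \<gamma>. snd \<gamma>))) 0 (\<gamma>, ?S)"
      using ex_isset[OF X S] unfolding \<gamma>' by blast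
    obtain c where c: "c \<in> fib (conn_ty \<beta> T) 0 ((\<gamma>, ?S), vertex_inclusion X)"
      using ex_conn[OF assms(2) X S] unfolding \<gamma>' by blast
    have "(?S, i, vertex_inclusion X, c) \<in> fib (set_cover_ty \<beta> T) 0 \<gamma>"
      using S i c vertex_inclusion_in[OF X]
      by (simp add: set_cover_ty_def sigma_ty_def prod_ty_def const_ty_def \<gamma>')
    with \<gamma> have "(\<gamma>, (?S, i, vertex_inclusion X, c)) \<in> splx (ext (ctx_X \<beta>) (set_cover_ty \<beta> T)) 0" by simp
    from is_term_in[OF \<mu> this] show "fib M 0 \<gamma> \<noteq> {}" by auto
  qed
  then obtain s where "is_term (ctx_X \<beta>) M s" ..
  from is_term_lam[OF simplicial_set_empty_ctx family_const[OF simplicial_set_univ] this[unfolded ctx_X_def]]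
  show ?thesis by blast
qed

end
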